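(* For every $(m,n)$-hook Young diagram $Y$, the crystal $B(Y)$ is connected.
   Context: Fix integers $m,n\ge1$. $I=\{\overline{m-1},\dots,\overline1,0,1,\dots,n-1\}$. $\mathbf B=\mathbf B_+\sqcup\mathbf B_-$, $\mathbf B_+=\{\overline m,\dots,\overline1\}$, $\mathbf B_-=\{1,\dots,n\}$, ordered by $\overline m<\overline{m-1}<\dots<\overline1<1<2<\dots<n$; $P=\bigoplus_{b\in\mathbf B}\mathbb Z\epsilon_b$. $\mathbf B$ is a crystal with $\mathrm{wt}(b)=\epsilon_b$ and $\tilde f_ib=b'$ (equivalently $\tilde e_ib'=b$) exactly for $(i,b,b')=(\overline k,\overline{k+1},\overline k)$ ($1\le k\le m-1$), $(0,\overline1,1)$, $(k,k,k+1)$ ($1\le k\le n-1$); all other values are $0$. For an element $b$ of a crystal put $\varepsilon_i(b)=\max\{r\ge0:\tilde e_i^rb\ne0\}$, $\varphi_i(b)=\max\{r\ge0:\tilde f_i^rb\ne0\}$. The tensor product of crystals has weights $\mathrm{wt}(b_1\otimes b_2)=\mathrm{wt}(b_1)+\mathrm{wt}(b_2)$ and operators (with $0\otimes b=b\otimes 0=0$): - $i=\overline k$: $\tilde e_i(b_1\otimes b_2)=\tilde e_ib_1\otimes b_2$ if $\varphi_i(b_1)\ge\varepsilon_i(b_2)$, else $b_1\otimes\tilde e_ib_2$; $\tilde f_i(b_1\otimes b_2)=\tilde f_ib_1\otimes b_2$ if $\varphi_i(b_1)>\varepsilon_i(b_2)$, else $b_1\otimes\tilde f_ib_2$. - $i\in\{1,\dots,n-1\}$: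 $\tilde e_i(b_1\otimes b_2)=b_1\otimes\tilde e_ib_2$ if $\varphi_i(b_2)\ge\varepsilon_i(b_1)$, else $\tilde e_ib_1\otimes b_2$; $\tilde f_i(b_1\otimes b_2)=b_1\otimes\tilde f_ib_2$ if $\varphi_i(b_2)>\varepsilon_i(b_1)$, else $\tilde f_ib_1\otimes b_2$. - $i=0$: with $\langle h_0,\sum_b\lambda_b\epsilon_b\rangle=\lambda_{\overline1}+\lambda_1$, the operators $\tilde e_0,\tilde f_0$ act on the first factor if $\langle h_0,\mathrm{wt}(b_1)\rangle>0$, and on the second factor if $\langle h_0,\mathrm{wt}(b_1)\rangle=0$. A Young diagram is an $(m,n)$-hook Young diagram if its $(m+1)$-st row has at most $n$ boxes. A semistandard tableau of shape $Y$ is a filling of the boxes of $Y$ with elements of $\mathbf B$ such that entries are weakly increasing along each row from left to right, with only elements of $\mathbf B_+$ allowed to repeat in a row, and weakly increasing down each column, with only elements of $\mathbf B_-$ allowed to repeat in a column. $B(Y)$ is the set of semistandard tableaux of shape $Y$, identified with a subset of $\mathbf B^{\otimes N}$ ($N$ = number of boxes of $Y$) by sending a tableau to $b_1\otimes\dots\otimes b_N$, where $b_1,\dots,b_N$ are its entries read column by column from right to left, each column from top to bottom. This subset together with $0$ is stable under all $\tilde e_i,\tilde f_i$ ($i\in I$), which gives $B(Y)$ its crystal structure (the same structure results from any admissible reading, i.e. any listing in which a box in position (row $i$, column $j$) precedes every other box $(i',j')$ with $i\le i'$, $j\ge j'$). A crystal is connected if the graph with edges $b\xrightarrow{i}\tilde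 f_ib$ (for $\tilde f_ib\neq0$, $i\in I$) is connected as an undirected graph. *)

theory Defs
  imports Graph_Theory.Digraph_Component
begin

section \<open>The alphabet and the index set\<close>

text \<open>\<open>Bar k\<close> stands for $\overline k$ and \<open>Pos k\<close> for $k$; likewise for the indices of the
  Kashiwara operators.  Only the labels in \<open>letters m n\<close> and \<open>indices m n\<close> are meaningful.\<close>

datatype letter = Bar nat | Pos nat

datatype index = IBar nat | IZero | IPos nat

definition letters_plus :: "nat \<Rightarrow> letter set" where
  "letters_plus m = Bar ` {1..m}"

definition letters_minus :: "nat \<Rightarrow> letter set" where
  "letters_minus n = Pos ` {1..n}"

definition letters :: "nat \<Rightarrow> nat \<Rightarrow> letter set" where
  "letters m n = letters_plus m \<union> letters_minus n"

definition indices :: "nat \<Rightarrow> nat \<Rightarrow> index set" where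
  "indices m n = IBar ` {1..<m} \<union> {IZero} \<union> IPos ` {1..<n}"

instantiation letter :: linorder
begin

fun less_eq_letter :: "letter \<Rightarrow> letter \<Rightarrow> bool" where
  "Bar j \<le> Bar k \<longleftrightarrow> k \<le> j"
| "Bar j \<le> Pos k \<longleftrightarrow> True"
| "Pos j \<le> Bar k \<longleftrightarrow> False"
| "Pos j \<le> Pos k \<longleftrightarrow> j \<le> k"

definition less_letter :: "letter \<Rightarrow> letter \<Rightarrow> bool" where
  "a < b \<longleftrightarrow> a \<le> b \<and> \<not> b \<le> (a :: letter)"

instance
proof
  fix x y z :: letter
  show "x < y \<longleftrightarrow> x \<le> y \<and> \<not> y \<le> x" by (fact less_letter_def)
  show "x \<le> x" by (cases x) auto
  show "x \<le> y \<Longrightarrow> y \<le> z \<Longrightarrow> x \<le> z" by (cases x; cases y; cases z) auto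
  show "x \<le> y \<Longrightarrow> y \<le> x \<Longrightarrow> x = y" by (cases x; cases y) auto
  show "x \<le> y \<or> y \<le> x" by (cases x; cases y) auto
qed

end

section \<open>Crystals and their tensor product\<close>

text \<open>An element $\sum_b \lambda_b\epsilon_b$ of the weight lattice is its coefficient function
  $b \mapsto \lambda_b$.\<close>

type_synonym weight = "letter \<Rightarrow> int"

definition h0_pairing :: "weight \<Rightarrow> int" where
  "h0_pairing l = l (Bar 1) + l (Pos 1)"

text \<open>In the operators, \<open>None\<close> plays the role of the extra element $0$.\<close>

record 'a crystal =
  elems :: "'a set"
  wt :: "'a \<Rightarrow> weight"
  eop :: "index \<Rightarrow> 'a \<Rightarrow> 'a option"
  fop :: "index \<Rightarrow> 'a \<Rightarrow> 'a option"

definition max_iter :: "('a \<Rightarrow> 'a option) \<Rightarrow> 'a \<Rightarrow> nat" where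
  "max_iter g b = Max {r. ((\<lambda>x. Option.bind x g) ^^ r) (Some b) \<noteq> None}"

definition eps :: "'a crystal \<Rightarrow> index \<Rightarrow> 'a \<Rightarrow> nat" where
  "eps C i b = max_iter (eop C i) b"

definition phi :: "'a crystal \<Rightarrow> index \<Rightarrow> 'a \<Rightarrow> nat" where
  "phi C i b = max_iter (fop C i) b"

definition tensor :: "'a crystal \<Rightarrow> 'b crystal \<Rightarrow> ('a \<times> 'b) crystal" where
  "tensor C D = \<lparr>
     elems = elems C \<times> elems D,
     wt = (\<lambda>(b1, b2) c. wt C b1 c + wt D b2 c),
     eop = (\<lambda>i (b1, b2).
       let first = map_option (\<lambda>x. (x, b2)) (eop C i b1);
           second = map_option (\<lambda>y. (b1, y)) (eop D i b2)
       in case i of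
            IBar k \<Rightarrow> if phi C i b1 \<ge> eps D i b2 then first else second
          | IZero \<Rightarrow> if h0_pairing (wt C b1) > 0 then first else second
          | IPos k \<Rightarrow> if phi D i b2 \<ge> eps C i b1 then second else first),
     fop = (\<lambda>i (b1, b2).
       let first = map_option (\<lambda>x. (x, b2)) (fop C i b1);
           second = map_option (\<lambda>y. (b1, y)) (fop D i b2)
       in case i of
            IBar k \<Rightarrow> if phi C i b1 > eps D i b2 then first else second
          | IZero \<Rightarrow> if h0_pairing (wt C b1) > 0 then first else second
          | IPos k \<Rightarrow> if phi D i b2 > eps C i b1 then second else first)\<rparr>"

fun letter_f :: "nat \<Rightarrow> nat \<Rightarrow> index \<Rightarrow> letter \<Rightarrow> letter option" where
  "letter_f m n (IBar k) b = (if 1 \<le> k \<and> k < m \<and> b = Bar (k + 1) then Some (Bar k) else None)"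
| "letter_f m n IZero b = (if b = Bar 1 then Some (Pos 1) else None)"
| "letter_f m n (IPos k) b = (if 1 \<le> k \<and> k < n \<and> b = Pos k then Some (Pos (k + 1)) else None)"

fun letter_e :: "nat \<Rightarrow> nat \<Rightarrow> index \<Rightarrow> letter \<Rightarrow> letter option" where
  "letter_e m n (IBar k) b = (if 1 \<le> k \<and> k < m \<and> b = Bar k then Some (Bar (k + 1)) else None)"
| "letter_e m n IZero b = (if b = Pos 1 then Some (Bar 1) else None)"
| "letter_e m n (IPos k) b = (if 1 \<le> k \<and> k < n \<and> b = Pos (k + 1) then Some (Pos k) else None)"

definition letter_crystal :: "nat \<Rightarrow> nat \<Rightarrow> letter crystal" where
  "letter_crystal m n = \<lparr>
     elems = letters m n,
     wt = (\<lambda>b c. if c = b then 1 else 0),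
     eop = letter_e m n,
     fop = letter_f m n\<rparr>"

text \<open>The power $\mathbf B^{\otimes N}$, with $b_1\otimes\dots\otimes b_N$ written as the list
  \<open>[b\<^sub>1, \<dots>, b\<^sub>N]\<close>.  It is bracketed as $\mathbf B\otimes\mathbf B^{\otimes(N-1)}$ and
  transported from pairs to lists along $(b,w)\mapsto b\,\#\,w$.  The power for $N=0$ is the
  one-element crystal of weight $0$ on which all operators vanish; it is a unit for \<open>tensor\<close>,
  so that the power for $N=1$ is $\mathbf B$ itself.\<close>

primrec tensor_power :: "nat \<Rightarrow> nat \<Rightarrow> nat \<Rightarrow> letter list crystal" where
  "tensor_power m n 0 = \<lparr>
     elems = {[]}, wt = (\<lambda>_ _. 0), eop = (\<lambda>_ _. None), fop = (\<lambda>_ _. None)\<rparr>"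
| "tensor_power m n (Suc N) =
     (let T = tensor (letter_crystal m n) (tensor_power m n N);
          to_list = (\<lambda>(b, w). b # w);
          of_list = (\<lambda>w. (hd w, tl w))
      in \<lparr> elems = to_list ` elems T,
           wt = (\<lambda>w. wt T (of_list w)),
           eop = (\<lambda>i w. map_option to_list (eop T i (of_list w))),
           fop = (\<lambda>i w. map_option to_list (fop T i (of_list w)))\<rparr>)"

definition crystal_graph ::
  "index set \<Rightarrow> 'a crystal \<Rightarrow> ('a, 'a \<times> index \<times> 'a) pre_digraph" where
  "crystal_graph I C = \<lparr>
     verts = elems C,
     arcs = {(b, i, b'). b \<in> elems C \<and> i \<in> I \<and> fop C i b = Some b'},
     tail = (\<lambda>(b, i, b'). b),
     head = (\<lambda>(b, i, b'). b')\<rparr>"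

text \<open>\<open>Digraph_Component.connected\<close> refers to the underlying undirected graph, which is required
  to be nonempty.\<close>

definition crystal_connected :: "index set \<Rightarrow> 'a crystal \<Rightarrow> bool" where
  "crystal_connected I C \<longleftrightarrow> Digraph_Component.connected (crystal_graph I C)"

section \<open>Young diagrams and semistandard tableaux\<close>

text \<open>A Young diagram is given by its set of boxes \<open>(i, j)\<close> (row \<open>i\<close>, column \<open>j\<close>), where rows are
  numbered from top to bottom and columns from left to right, both starting from 1.\<close>

type_synonym box = "nat \<times> nat"

definition young_diagram :: "box set \<Rightarrow> bool" where
  "young_diagram Y \<longleftrightarrow> finite Y \<and> Y \<subseteq> {1..} \<times> {1..} \<and>
     (\<forall>i j i' j'. (i, j) \<in> Y \<longrightarrow> 1 \<le> i' \<longrightarrow> i' \<le> i \<longrightarrow> 1 \<le> j' \<longrightarrow> j' \<le> j \<longrightarrow> (i', j') \<in> Y)"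

definition row_length :: "box set \<Rightarrow> nat \<Rightarrow> nat" where
  "row_length Y i = card {j. (i, j) \<in> Y}"

definition column_length :: "box set \<Rightarrow> nat \<Rightarrow> nat" where
  "column_length Y j = card {i. (i, j) \<in> Y}"

definition hook_young_diagram :: "nat \<Rightarrow> nat \<Rightarrow> box set \<Rightarrow> bool" where
  "hook_young_diagram m n Y \<longleftrightarrow> young_diagram Y \<and> row_length Y (m + 1) \<le> n"

text \<open>Only the values of \<open>T\<close> on \<open>Y\<close> matter.\<close>

definition semistandard :: "nat \<Rightarrow> nat \<Rightarrow> box set \<Rightarrow> (box \<Rightarrow> letter) \<Rightarrow> bool" where
  "semistandard m n Y T \<longleftrightarrow>
     (\<forall>x \<in> Y. T x \<in> letters m n) \<and>
     (\<forall>i j j'. (i, j) \<in> Y \<longrightarrow> (i, j') \<in> Y \<longrightarrow> j < j' \<longrightarrow>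
        T (i, j) \<le> T (i, j') \<and> (T (i, j) = T (i, j') \<longrightarrow> T (i, j) \<in> letters_plus m)) \<and>
     (\<forall>i i' j. (i, j) \<in> Y \<longrightarrow> (i', j) \<in> Y \<longrightarrow> i < i' \<longrightarrow>
        T (i, j) \<le> T (i', j) \<and> (T (i, j) = T (i', j) \<longrightarrow> T (i, j) \<in> letters_minus n))"

text \<open>The boxes column by column from right to left, each column from top to bottom.\<close>

definition reading_order :: "box set \<Rightarrow> box list" where
  "reading_order Y =
     concat (map (\<lambda>j. map (\<lambda>i. (i, j)) [1..<Suc (column_length Y j)])
                 (rev [1..<Suc (row_length Y 1)]))"

definition reading_word :: "box set \<Rightarrow> (box \<Rightarrow> letter) \<Rightarrow> letter list" where
  "reading_word Y T = map T (reading_order Y)"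

text \<open>$B(Y)$ consists of the reading words of the semistandard tableaux of shape $Y$.  Being stable
  under the operators (up to $0$), it simply inherits them from $\mathbf B^{\otimes N}$.\<close>

definition tableau_crystal :: "nat \<Rightarrow> nat \<Rightarrow> box set \<Rightarrow> letter list crystal" where
  "tableau_crystal m n Y =
     (tensor_power m n (card Y))\<lparr>elems := {reading_word Y T | T. semistandard m n Y T}\<rparr>"

end

theory Submission
  imports Defs
begin

text \<open>
The proof goes by induction on the largest letter \<open>x\<close> that entries may take, following the order
$\overline m<\dots<\overline1<1<\dots<n$.  For a tableau \<open>T\<close> the boxes that do not contain \<open>x\<close> form a smaller
Young diagram \<open>Z\<close>, and operators that only involve letters smaller than \<open>x\<close> act on \<open>T\<close> as they act on its
restriction to \<open>Z\<close>.  By induction, therefore, \<open>T\<close> is connected to every tableau with the same set of boxes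
filled with \<open>x\<close> (\<open>linked_to_overlay\<close>), and it remains to connect \<open>T\<close> to a tableau in which that set has a
normal form that depends on the shape alone (\<open>all_linked_step\<close>).

There is at most one tableau whose entries are all $\overline m$.  If \<open>x\<close> is $\overline k$ with $k<m$, the normal form is the set of all column ends.  First the restriction
to \<open>Z\<close> is replaced by one in which every column ends with the predecessor $\overline{k+1}$ of \<open>x\<close>.  In the
signature of $\tilde f_{\overline k}$ nothing then cancels except pairs within one column that ends with
\<open>x\<close>, so that the operator acts on the end of a column that does not end with \<open>x\<close>
(\<open>raise_column_end\<close>).  Repetition fills all column ends.  If \<open>x\<close> is $k+1$ with $k\ge1$, the same argument
with rows instead of columns applies (\<open>raise_row_end\<close>).

If \<open>x\<close> is 1, this argument fails because $\tilde f_0$ sees only the first of the letters $\overline1$ and 1.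
Here the restriction to \<open>Z\<close> is replaced by the highest weight tableau, in which $\overline1$ occurs only in
row \<open>m\<close>.  As long as some 1 lies in the first \<open>m\<close> rows, the first 1 in the reading precedes all
$\overline1$, so $\tilde e_0$ turns it into $\overline1$ (\<open>lower_first_Pos\<close>).  The normal form is reached when the
boxes containing 1 are exactly those below row \<open>m\<close>.

Climbing along the operators $\tilde e_i$ alone would not be enough: a tableau killed by all of them
need not be the highest weight tableau.  The moves above therefore go up for some letters and down for
others.  The hook condition makes the set of tableaux nonempty (\<open>semistandard_exists\<close>).
\<close>

section \<open>String lengths on tensor powers of the alphabet\<close>

lemma max_iter_eq:
  assumes none: "\<And>b. b \<in> S \<Longrightarrow> g b = None \<longleftrightarrow> P b = 0"
    and some: "\<And>b b'. b \<in> S \<Longrightarrow> g b = Some b' \<Longrightarrow> b' \<in> S \<and> P b = Suc (P b')"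
    and "b \<in> S"
  shows "max_iter g b = P b"
proof -
  have none_iter: "((\<lambda>x. Option.bind x g) ^^ r) None = None" for r
    by (induction r) auto
  have "((\<lambda>x. Option.bind x g) ^^ r) (Some b) \<noteq> None \<longleftrightarrow> r \<le> P b" for r
    using \<open>b \<in> S\<close>
  proof (induction r arbitrary: b)
    case 0
    then show ?case by simp
  next
    case (Suc r)
    show ?case
    proof (cases "g b")
      case None
      then show ?thesis
        using none[of b] Suc.prems none_iter by (simp add: funpow_Suc_right del: funpow.simps)
    next
      case (Some b')
      then have "b' \<in> S" "P b = Suc (P b')" using some Suc.prems by auto
      then show ?thesis
        using Some Suc.IH[of b'] by (simp add: funpow_Suc_right del: funpow.simps)
    qed
  qed
  then have "{r. ((\<lambda>x. Option.bind x g) ^^ r) (Some b) \<noteq> None} = {..P b}"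
    by auto
  moreover have "Max {..P b} = P b"
    by (rule Max_eqI) auto
  ultimately show ?thesis by (simp only: max_iter_def)
qed

text \<open>A candidate pair for $\varepsilon_i$ and $\varphi_i$: the clauses for $\tilde e_i$ and $\tilde f_i$
record how both functions change along an $i$-string, so they determine the functions on \<open>S\<close>.
Working with candidates avoids any direct computation with maxima of iterates; the maxima are
identified once, in \<open>phi_eps_eq\<close>.\<close>

definition string_lengths ::
  "'a set \<Rightarrow> 'a crystal \<Rightarrow> index \<Rightarrow> ('a \<Rightarrow> nat) \<Rightarrow> ('a \<Rightarrow> nat) \<Rightarrow> bool" where
  "string_lengths S C i E P \<longleftrightarrow> (\<forall>b \<in> S.
     (fop C i b = None \<longleftrightarrow> P b = 0) \<and> (eop C i b = None \<longleftrightarrow> E b = 0) \<and>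
     (\<forall>b'. fop C i b = Some b' \<longrightarrow> b' \<in> S \<and> P b = Suc (P b') \<and> E b' = Suc (E b)) \<and>
     (\<forall>b'. eop C i b = Some b' \<longrightarrow> b' \<in> S \<and> E b = Suc (E b') \<and> P b' = Suc (P b)))"

lemma string_lengths_noneD:
  assumes "string_lengths S C i E P" and "b \<in> S"
  shows "fop C i b = None \<longleftrightarrow> P b = 0" and "eop C i b = None \<longleftrightarrow> E b = 0"
  using assms unfolding string_lengths_def by blast+

lemma string_lengths_fopD:
  assumes "string_lengths S C i E P" and "fop C i b = Some b'" and "b \<in> S"
  shows "b' \<in> S \<and> P b = Suc (P b') \<and> E b' = Suc (E b)"
  using assms unfolding string_lengths_def by blast

lemma string_lengths_eopD:
  assumes "string_lengths S C i E P" and "eop C i b = Some b'" and "b \<in> S"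
  shows "b' \<in> S \<and> E b = Suc (E b') \<and> P b' = Suc (P b)"
  using assms unfolding string_lengths_def by blast

lemma phi_eps_eq:
  assumes "string_lengths S C i E P" and "b \<in> S"
  shows "phi C i b = P b" and "eps C i b = E b"
proof -
  show "phi C i b = P b"
    unfolding phi_def using assms(2)
    by (rule max_iter_eq[where S = S, rotated 2])
      (auto simp: string_lengths_noneD[OF assms(1)] dest: string_lengths_fopD[OF assms(1)])
  show "eps C i b = E b"
    unfolding eps_def using assms(2)
    by (rule max_iter_eq[where S = S, rotated 2])
      (auto simp: string_lengths_noneD[OF assms(1)] dest: string_lengths_eopD[OF assms(1)])
qed

lemma string_lengths_eps_phi:
  assumes "string_lengths S C i E P"
  shows "string_lengths S C i (eps C i) (phi C i)"
  unfolding string_lengths_def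
proof (intro ballI conjI allI impI, goal_cases)
  case (1 b)
  then show ?case using string_lengths_noneD[OF assms] phi_eps_eq[OF assms] by simp
next
  case (2 b)
  then show ?case using string_lengths_noneD[OF assms] phi_eps_eq[OF assms] by simp
qed (use phi_eps_eq[OF assms] in \<open>auto dest!: string_lengths_fopD[OF assms] string_lengths_eopD[OF assms]\<close>)

text \<open>In $b_1\otimes b_2$ the $\varphi_i(b_1)$ possible lowerings of $b_1$ cancel against the
$\varepsilon_i(b_2)$ possible raisings of $b_2$; the truncated differences count what is left.
For $i\in\{1,\dots,n-1\}$ the two factors exchange roles.\<close>

lemma string_lengths_tensor_IBar:
  assumes C: "string_lengths S C (IBar k) E P" and D: "string_lengths S' D (IBar k) E' P'"
  shows "string_lengths (S \<times> S') (tensor C D) (IBar k)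
    (\<lambda>(b, b'). E b + (E' b' - P b)) (\<lambda>(b, b'). P' b' + (P b - E' b'))"
  unfolding string_lengths_def
proof (rule ballI, goal_cases)
  case (1 c)
  then obtain a b where c: "c = (a, b)" and ab: "a \<in> S" "b \<in> S'" by blast
  note strings = phi_eps_eq[OF C ab(1)] phi_eps_eq[OF D ab(2)]
  have fop: "fop (tensor C D) (IBar k) (a, b) = (if E' b < P a then map_option (\<lambda>x. (x, b)) (fop C (IBar k) a) else map_option (\<lambda>y. (a, y)) (fop D (IBar k) b))"
    using strings by (simp add: tensor_def)
  have eop: "eop (tensor C D) (IBar k) (a, b) = (if E' b \<le> P a then map_option (\<lambda>x. (x, b)) (eop C (IBar k) a) else map_option (\<lambda>y. (a, y)) (eop D (IBar k) b))"
    using strings by (simp add: tensor_def)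
  show ?case
    unfolding c prod.case fop eop
  proof (intro conjI allI impI, goal_cases)
    case 1
    then show ?case
      using string_lengths_noneD[OF C ab(1)] string_lengths_noneD[OF D ab(2)] by auto
  next
    case 2
    then show ?case
      using string_lengths_noneD[OF C ab(1)] string_lengths_noneD[OF D ab(2)] by auto
  qed (use ab in \<open>auto split: if_splits
      dest: string_lengths_fopD[OF C _ ab(1)] string_lengths_fopD[OF D _ ab(2)]
        string_lengths_eopD[OF C _ ab(1)] string_lengths_eopD[OF D _ ab(2)]\<close>)
qed

lemma string_lengths_tensor_IPos:
  assumes C: "string_lengths S C (IPos k) E P" and D: "string_lengths S' D (IPos k) E' P'"
  shows "string_lengths (S \<times> S') (tensor C D) (IPos k)
    (\<lambda>(b, b'). E' b' + (E b - P' b')) (\<lambda>(b, b'). P b + (P' b' - E b))"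
  unfolding string_lengths_def
proof (rule ballI, goal_cases)
  case (1 c)
  then obtain a b where c: "c = (a, b)" and ab: "a \<in> S" "b \<in> S'" by blast
  note strings = phi_eps_eq[OF C ab(1)] phi_eps_eq[OF D ab(2)]
  have fop: "fop (tensor C D) (IPos k) (a, b) = (if E a < P' b then map_option (\<lambda>y. (a, y)) (fop D (IPos k) b) else map_option (\<lambda>x. (x, b)) (fop C (IPos k) a))"
    using strings by (simp add: tensor_def)
  have eop: "eop (tensor C D) (IPos k) (a, b) = (if E a \<le> P' b then map_option (\<lambda>y. (a, y)) (eop D (IPos k) b) else map_option (\<lambda>x. (x, b)) (eop C (IPos k) a))"
    using strings by (simp add: tensor_def)
  show ?case
    unfolding c prod.case fop eop
  proof (intro conjI allI impI, goal_cases)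
    case 1
    then show ?case
      using string_lengths_noneD[OF C ab(1)] string_lengths_noneD[OF D ab(2)] by auto
  next
    case 2
    then show ?case
      using string_lengths_noneD[OF C ab(1)] string_lengths_noneD[OF D ab(2)] by auto
  qed (use ab in \<open>auto split: if_splits
      dest: string_lengths_fopD[OF C _ ab(1)] string_lengths_fopD[OF D _ ab(2)]
        string_lengths_eopD[OF C _ ab(1)] string_lengths_eopD[OF D _ ab(2)]\<close>)
qed

lemma string_lengths_letter_IBar:
  "1 \<le> k \<Longrightarrow> k < m \<Longrightarrow> string_lengths UNIV (letter_crystal m n) (IBar k)
     (\<lambda>b. of_bool (b = Bar k)) (\<lambda>b. of_bool (b = Bar (k + 1)))"
  by (auto simp: string_lengths_def letter_crystal_def)

lemma string_lengths_letter_IPos: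
  "1 \<le> k \<Longrightarrow> k < n \<Longrightarrow> string_lengths UNIV (letter_crystal m n) (IPos k)
     (\<lambda>b. of_bool (b = Pos (k + 1))) (\<lambda>b. of_bool (b = Pos k))"
  by (auto simp: string_lengths_def letter_crystal_def)

lemma string_lengths_power_Suc:
  assumes "string_lengths (UNIV \<times> {w. length w = N})
    (tensor (letter_crystal m n) (tensor_power m n N)) i E P"
  shows "string_lengths {w. length w = Suc N} (tensor_power m n (Suc N)) i
    (\<lambda>w. E (hd w, tl w)) (\<lambda>w. P (hd w, tl w))"
  unfolding string_lengths_def
proof (intro ballI conjI allI impI, goal_cases)
  case (1 w)
  then have "(hd w, tl w) \<in> UNIV \<times> {w. length w = N}" by simp
  then show ?case using string_lengths_noneD(1)[OF assms] by (simp add: Let_def)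
next
  case (2 w)
  then have "(hd w, tl w) \<in> UNIV \<times> {w. length w = N}" by simp
  then show ?case using string_lengths_noneD(2)[OF assms] by (simp add: Let_def)
qed (auto simp: Let_def dest!: string_lengths_fopD[OF assms] string_lengths_eopD[OF assms])

lemma string_lengths_power_IBar:
  assumes k: "1 \<le> k" "k < m"
  shows "string_lengths {w. length w = N} (tensor_power m n N) (IBar k)
    (eps (tensor_power m n N) (IBar k)) (phi (tensor_power m n N) (IBar k))"
proof -
  have "\<exists>E P. string_lengths {w. length w = N} (tensor_power m n N) (IBar k) E P"
  proof (induction N)
    case 0
    have "string_lengths {w. length w = 0} (tensor_power m n 0) (IBar k) (\<lambda>_. 0) (\<lambda>_. 0)"
      by (auto simp: string_lengths_def)
    then show ?case by blast
  next
    case (Suc N)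
    then obtain E P where "string_lengths {w. length w = N} (tensor_power m n N) (IBar k) E P"
      by blast
    from string_lengths_power_Suc[OF string_lengths_tensor_IBar[OF
          string_lengths_letter_IBar[OF k] this]]
    show ?case by blast
  qed
  then show ?thesis by (blast intro: string_lengths_eps_phi)
qed

lemma string_lengths_power_IPos:
  assumes k: "1 \<le> k" "k < n"
  shows "string_lengths {w. length w = N} (tensor_power m n N) (IPos k)
    (eps (tensor_power m n N) (IPos k)) (phi (tensor_power m n N) (IPos k))"
proof -
  have "\<exists>E P. string_lengths {w. length w = N} (tensor_power m n N) (IPos k) E P"
  proof (induction N)
    case 0
    have "string_lengths {w. length w = 0} (tensor_power m n 0) (IPos k) (\<lambda>_. 0) (\<lambda>_. 0)"
      by (auto simp: string_lengths_def)
    then show ?case by blast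
  next
    case (Suc N)
    then obtain E P where "string_lengths {w. length w = N} (tensor_power m n N) (IPos k) E P"
      by blast
    from string_lengths_power_Suc[OF string_lengths_tensor_IPos[OF
          string_lengths_letter_IPos[OF k] this]]
    show ?case by blast
  qed
  then show ?thesis by (blast intro: string_lengths_eps_phi)
qed

text \<open>Only one of the two string lengths has to be followed along a word: $\tilde f_{\overline k}$ acts on
the first letter exactly if it finds nothing to cancel in the tail, which is a question about
$\varepsilon_{\overline k}$ of the tail; for $\tilde f_k$ it is a question about $\varphi_k$.\<close>

lemma eps_IBar_Cons:
  assumes k: "1 \<le> k" "k < m"
  shows "eps (tensor_power m n (length (a # w))) (IBar k) (a # w) =
    of_bool (a = Bar k) + (eps (tensor_power m n (length w)) (IBar k) w - of_bool (a = Bar (k + 1)))"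
  using phi_eps_eq(2)[OF string_lengths_power_Suc[OF string_lengths_tensor_IBar[OF
        string_lengths_letter_IBar[OF k, of n] string_lengths_power_IBar[OF k, of "length w" n]]], of "a # w"]
  by simp

lemma phi_IPos_Cons:
  assumes k: "1 \<le> k" "k < n"
  shows "phi (tensor_power m n (length (a # w))) (IPos k) (a # w) =
    of_bool (a = Pos k) + (phi (tensor_power m n (length w)) (IPos k) w - of_bool (a = Pos (k + 1)))"
  using phi_eps_eq(1)[OF string_lengths_power_Suc[OF string_lengths_tensor_IPos[OF
        string_lengths_letter_IPos[OF k, of m] string_lengths_power_IPos[OF k, of "length w" m]]], of "a # w"]
  by simp

lemma fop_IBar_Cons:
  assumes k: "1 \<le> k" "k < m"
  shows "fop (tensor_power m n (length (a # w))) (IBar k) (a # w) =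
    (if a = Bar (k + 1) \<and> eps (tensor_power m n (length w)) (IBar k) w = 0
     then Some (Bar k # w)
     else map_option ((#) a) (fop (tensor_power m n (length w)) (IBar k) w))"
proof -
  have "phi (letter_crystal m n) (IBar k) a = of_bool (a = Bar (k + 1))"
    using phi_eps_eq(1)[OF string_lengths_letter_IBar[OF k]] by simp
  then show ?thesis
    using k by (auto simp: tensor_def Let_def letter_crystal_def option.map_comp o_def)
qed

lemma fop_IPos_Cons:
  assumes k: "1 \<le> k" "k < n"
  shows "fop (tensor_power m n (length (a # w))) (IPos k) (a # w) =
    (if phi (tensor_power m n (length w)) (IPos k) w > of_bool (a = Pos (k + 1))
     then map_option ((#) a) (fop (tensor_power m n (length w)) (IPos k) w)
     else if a = Pos k then Some (Pos (k + 1) # w) else None)"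
proof -
  have "eps (letter_crystal m n) (IPos k) a = of_bool (a = Pos (k + 1))"
    using phi_eps_eq(2)[OF string_lengths_letter_IPos[OF k]] by simp
  then show ?thesis
    using k by (auto simp: tensor_def Let_def letter_crystal_def option.map_comp o_def)
qed

lemma fop_IZero_Cons:
  "fop (tensor_power m n (length (a # w))) IZero (a # w) =
    (if a = Bar 1 \<or> a = Pos 1 then map_option (\<lambda>b. b # w) (letter_f m n IZero a)
     else map_option ((#) a) (fop (tensor_power m n (length w)) IZero w))"
  by (auto simp: tensor_def Let_def letter_crystal_def option.map_comp o_def h0_pairing_def)

section \<open>The signature criterion for words\<close>

text \<open>The cancellation condition of the signature rule at a distinguished position with \<open>u\<close> to its left
and \<open>v\<close> to its right: with \<open>a\<close> as opening and \<open>b\<close> as closing bracket, every \<open>a\<close> in \<open>u\<close> is matched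
inside \<open>u\<close> and every \<open>b\<close> in \<open>v\<close> is matched inside \<open>v\<close>.  Then nothing cancels against the
distinguished letter, and nothing uncancelled stands between it and the place where the operator
looks first.\<close>

definition balanced_around :: "'a \<Rightarrow> 'a \<Rightarrow> 'a list \<Rightarrow> 'a list \<Rightarrow> bool" where
  "balanced_around a b u v \<longleftrightarrow>
     (\<forall>u1 u2. u = u1 @ u2 \<longrightarrow> count_list u2 a \<le> count_list u2 b) \<and>
     (\<forall>v1 v2. v = v1 @ v2 \<longrightarrow> count_list v1 b \<le> count_list v1 a)"

lemma balanced_around_ConsD: "balanced_around a b (c # u) v \<Longrightarrow> balanced_around a b u v"
  unfolding balanced_around_def by (metis append_Cons)

lemma balanced_around_prefix: "balanced_around a b u v \<Longrightarrow> count_list u a \<le> count_list u b"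
  unfolding balanced_around_def by (metis append_Nil)

text \<open>The string length of a word is a maximum over its prefixes of a difference of two letter counts.
The next two lemmas say that the maximum is attained, the two after them that it is an upper bound.\<close>

lemma eps_IBar_prefix:
  assumes "1 \<le> k" "k < m"
  shows "\<exists>v1 v2. v = v1 @ v2 \<and>
    count_list v1 (Bar k) = eps (tensor_power m n (length v)) (IBar k) v + count_list v1 (Bar (k + 1))"
proof (induction v)
  case Nil
  have "eps (tensor_power m n 0) (IBar k) [] = 0"
    using string_lengths_power_IBar[OF assms, of 0 n] by (simp add: string_lengths_def)
  then show ?case by simp
next
  case (Cons a v)
  then obtain v1 v2 where v: "v = v1 @ v2" "count_list v1 (Bar k) =
    eps (tensor_power m n (length v)) (IBar k) v + count_list v1 (Bar (k + 1))" by blast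
  show ?case
  proof (cases "a = Bar (k + 1) \<and> eps (tensor_power m n (length v)) (IBar k) v = 0")
    case True
    then show ?thesis
      using eps_IBar_Cons[OF assms, of n a v] by (intro exI[of _ "[]"] exI[of _ "a # v"]) simp
  next
    case False
    then show ?thesis
      using eps_IBar_Cons[OF assms, of n a v] v
      by (intro exI[of _ "a # v1"] exI[of _ v2]) auto
  qed
qed

lemma phi_IPos_prefix:
  assumes "1 \<le> k" "k < n"
  shows "\<exists>v1 v2. v = v1 @ v2 \<and>
    count_list v1 (Pos k) = phi (tensor_power m n (length v)) (IPos k) v + count_list v1 (Pos (k + 1))"
proof (induction v)
  case Nil
  have "phi (tensor_power m n 0) (IPos k) [] = 0"
    using string_lengths_power_IPos[OF assms, of 0 m] by (simp add: string_lengths_def)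
  then show ?case by simp
next
  case (Cons a v)
  then obtain v1 v2 where v: "v = v1 @ v2" "count_list v1 (Pos k) =
    phi (tensor_power m n (length v)) (IPos k) v + count_list v1 (Pos (k + 1))" by blast
  show ?case
  proof (cases "a = Pos (k + 1) \<and> phi (tensor_power m n (length v)) (IPos k) v = 0")
    case True
    then show ?thesis
      using phi_IPos_Cons[OF assms, of m a v] by (intro exI[of _ "[]"] exI[of _ "a # v"]) simp
  next
    case False
    then show ?thesis
      using phi_IPos_Cons[OF assms, of m a v] v
      by (intro exI[of _ "a # v1"] exI[of _ v2]) auto
  qed
qed

lemma eps_IBar_ge:
  assumes "1 \<le> k" "k < m"
  shows "count_list u (Bar k) \<le>
    eps (tensor_power m n (length (u @ v))) (IBar k) (u @ v) + count_list u (Bar (k + 1))"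
proof (induction u)
  case (Cons a u)
  then show ?case using eps_IBar_Cons[OF assms, of n a "u @ v"] by auto
qed simp

lemma phi_IPos_ge:
  assumes "1 \<le> k" "k < n"
  shows "count_list u (Pos k) \<le>
    phi (tensor_power m n (length (u @ v))) (IPos k) (u @ v) + count_list u (Pos (k + 1))"
proof (induction u)
  case (Cons a u)
  then show ?case using phi_IPos_Cons[OF assms, of m a "u @ v"] by auto
qed simp

text \<open>A sufficient condition for the position at which an operator acts.  It is all that the connectedness
proof asks of the signature rule, because every arrow used there is exhibited explicitly.\<close>

lemma fop_IBar_balanced:
  assumes k: "1 \<le> k" "k < m" and "balanced_around (Bar (k + 1)) (Bar k) u v"
  shows "fop (tensor_power m n (length (u @ Bar (k + 1) # v))) (IBar k) (u @ Bar (k + 1) # v) =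
    Some (u @ Bar k # v)"
  using assms(3)
proof (induction u)
  case Nil
  have "eps (tensor_power m n (length v)) (IBar k) v = 0"
    using eps_IBar_prefix[OF k, of v n] Nil by (auto simp: balanced_around_def)
  then show ?case using fop_IBar_Cons[OF k, of n "Bar (k + 1)" v] by simp
next
  case (Cons a u)
  let ?w = "u @ Bar (k + 1) # v"
  have "eps (tensor_power m n (length ?w)) (IBar k) ?w > 0" if "a = Bar (k + 1)"
    using balanced_around_prefix[OF Cons.prems] that eps_IBar_ge[OF k, of u n "Bar (k + 1) # v"]
    by auto
  moreover have "fop (tensor_power m n (length ?w)) (IBar k) ?w = Some (u @ Bar k # v)"
    using Cons.IH balanced_around_ConsD[OF Cons.prems] by blast
  ultimately show ?case using fop_IBar_Cons[OF k, of n a ?w] by auto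
qed

lemma fop_IPos_balanced:
  assumes k: "1 \<le> k" "k < n" and "balanced_around (Pos (k + 1)) (Pos k) u v"
  shows "fop (tensor_power m n (length (u @ Pos k # v))) (IPos k) (u @ Pos k # v) =
    Some (u @ Pos (k + 1) # v)"
  using assms(3)
proof (induction u)
  case Nil
  have "phi (tensor_power m n (length v)) (IPos k) v = 0"
    using phi_IPos_prefix[OF k, of v m] Nil by (auto simp: balanced_around_def)
  then show ?case using fop_IPos_Cons[OF k, of m "Pos k" v] by simp
next
  case (Cons a u)
  let ?w = "u @ Pos k # v"
  have "count_list (u @ [Pos k]) (Pos k) \<le>
      phi (tensor_power m n (length ?w)) (IPos k) ?w + count_list (u @ [Pos k]) (Pos (k + 1))"
    using phi_IPos_ge[OF k, of "u @ [Pos k]" m v] by simp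
  then have "phi (tensor_power m n (length ?w)) (IPos k) ?w > of_bool (a = Pos (k + 1))"
    using balanced_around_prefix[OF Cons.prems] balanced_around_prefix[OF balanced_around_ConsD[OF Cons.prems]]
    by (auto split: if_splits)
  moreover have "fop (tensor_power m n (length ?w)) (IPos k) ?w = Some (u @ Pos (k + 1) # v)"
    using Cons.IH balanced_around_ConsD[OF Cons.prems] by blast
  ultimately show ?case using fop_IPos_Cons[OF k, of m a ?w] by auto
qed

lemma fop_IZero_first:
  assumes "Bar 1 \<notin> set u" "Pos 1 \<notin> set u"
  shows "fop (tensor_power m n (length (u @ Bar 1 # v))) IZero (u @ Bar 1 # v) =
    Some (u @ Pos 1 # v)"
  using assms
proof (induction u)
  case Nil
  then show ?case using fop_IZero_Cons[of m n "Bar 1" v] by simp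
next
  case (Cons a u)
  then show ?case using fop_IZero_Cons[of m n a "u @ Bar 1 # v"] by auto
qed

section \<open>The reading order of the boxes\<close>

definition read_before :: "box \<Rightarrow> box \<Rightarrow> bool" where
  "read_before p q \<longleftrightarrow> snd q < snd p \<or> snd p = snd q \<and> fst p < fst q"

lemma initial_segment_eq_atLeastAtMost_card:
  fixes A :: "nat set"
  assumes "finite A" "0 \<notin> A" and down: "\<And>i i'. i \<in> A \<Longrightarrow> 1 \<le> i' \<Longrightarrow> i' \<le> i \<Longrightarrow> i' \<in> A"
  shows "A = {1..card A}"
proof (cases "A = {}")
  case False
  have "A = {1..Max A}"
  proof (intro set_eqI iffI)
    fix i assume "i \<in> A"
    then show "i \<in> {1..Max A}" using assms(1,2) by (cases i) auto
  next
    fix i assume "i \<in> {1..Max A}"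
    then show "i \<in> A" using down[OF Max_in[OF assms(1) False]] by simp
  qed
  then show ?thesis by (metis card_atLeastAtMost diff_Suc_1)
qed simp

lemma young_diagram_memD:
  assumes "young_diagram Y" "(i, j) \<in> Y"
  shows "1 \<le> i" "1 \<le> j"
    and "\<And>i' j'. 1 \<le> i' \<Longrightarrow> i' \<le> i \<Longrightarrow> 1 \<le> j' \<Longrightarrow> j' \<le> j \<Longrightarrow> (i', j') \<in> Y"
  using assms unfolding young_diagram_def by auto

lemma young_diagram_column:
  assumes "young_diagram Y"
  shows "{i. (i, j) \<in> Y} = {1..column_length Y j}"
  unfolding column_length_def
proof (rule initial_segment_eq_atLeastAtMost_card)
  have "{i. (i, j) \<in> Y} \<subseteq> fst ` Y" by force
  then show "finite {i. (i, j) \<in> Y}"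
    using assms finite_subset unfolding young_diagram_def by blast
  show "0 \<notin> {i. (i, j) \<in> Y}" using young_diagram_memD(1)[OF assms] by fastforce
  show "i' \<in> {i. (i, j) \<in> Y}" if "i \<in> {i. (i, j) \<in> Y}" "1 \<le> i'" "i' \<le> i" for i i'
    using young_diagram_memD[OF assms, of i j] that by simp
qed

lemma young_diagram_row:
  assumes "young_diagram Y"
  shows "{j. (i, j) \<in> Y} = {1..row_length Y i}"
  unfolding row_length_def
proof (rule initial_segment_eq_atLeastAtMost_card)
  have "{j. (i, j) \<in> Y} \<subseteq> snd ` Y" by force
  then show "finite {j. (i, j) \<in> Y}"
    using assms finite_subset unfolding young_diagram_def by blast
  show "0 \<notin> {j. (i, j) \<in> Y}" using young_diagram_memD(2)[OF assms] by fastforce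
  show "j' \<in> {j. (i, j) \<in> Y}" if "j \<in> {j. (i, j) \<in> Y}" "1 \<le> j'" "j' \<le> j" for j j'
    using young_diagram_memD[OF assms, of i j] that by simp
qed

lemma set_reading_order:
  assumes "young_diagram Y"
  shows "set (reading_order Y) = Y"
proof -
  have col: "(i, j) \<in> Y \<longleftrightarrow> 1 \<le> i \<and> i \<le> column_length Y j" for i j
    using young_diagram_column[OF assms, of j] by auto
  have row: "(1, j) \<in> Y \<longleftrightarrow> 1 \<le> j \<and> j \<le> row_length Y 1" for j
    using young_diagram_row[OF assms, of 1] by auto
  have "(i, j) \<in> set (reading_order Y) \<longleftrightarrow>
      (1 \<le> j \<and> j \<le> row_length Y 1) \<and> 1 \<le> i \<and> i \<le> column_length Y j" for i j
    by (auto simp: reading_order_def image_iff simp del: upt_Suc)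
  moreover have "(1, j) \<in> Y" if "(i, j) \<in> Y" for i j
    using young_diagram_memD[OF assms that] by auto
  ultimately have "(i, j) \<in> set (reading_order Y) \<longleftrightarrow> (i, j) \<in> Y" for i j
    using row[of j] col[of i j] by blast
  then show ?thesis by auto
qed

lemma sorted_wrt_reading_order: "sorted_wrt read_before (reading_order Y)"
proof -
  have "sorted_wrt read_before (concat (map (\<lambda>j. map (\<lambda>i. (i, j)) [1..<Suc (c j)]) js))"
    if "sorted_wrt (>) js" for c :: "nat \<Rightarrow> nat" and js
    using that
  proof (induction js)
    case (Cons j js)
    have "sorted_wrt read_before (map (\<lambda>i. (i, j)) [1..<Suc (c j)])"
      unfolding sorted_wrt_map read_before_def by (simp del: upt_Suc)
    then show ?case
      using Cons by (auto simp: sorted_wrt_append simp del: upt_Suc) (auto simp: read_before_def)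
  qed simp
  then show ?thesis
    unfolding reading_order_def by (simp add: sorted_wrt_rev del: upt_Suc)
qed

lemma distinct_reading_order: "distinct (reading_order Y)"
proof -
  have "distinct ps" if "sorted_wrt read_before ps" for ps
    using that by (induction ps) (auto simp: read_before_def)
  then show ?thesis using sorted_wrt_reading_order by blast
qed

lemma length_reading_order: "young_diagram Y \<Longrightarrow> length (reading_order Y) = card Y"
  using distinct_card[OF distinct_reading_order, of Y] set_reading_order by simp

section \<open>Arrows between fillings\<close>

text \<open>The condition \<open>balanced_around\<close> on the reading word of \<open>T\<close>, phrased with boxes instead of positions.
The bound \<open>r\<close> ranges over all boxes of the plane, so that the condition depends only on the places of
the letters \<open>a\<close> and \<open>b\<close> and is insensitive to boxes of \<open>Y\<close> that carry other letters.\<close>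

definition balanced_at :: "'a \<Rightarrow> 'a \<Rightarrow> box set \<Rightarrow> (box \<Rightarrow> 'a) \<Rightarrow> box \<Rightarrow> bool" where
  "balanced_at a b Y T p \<longleftrightarrow>
     (\<forall>r. card {q \<in> Y. T q = a \<and> \<not> read_before q r \<and> read_before q p}
        \<le> card {q \<in> Y. T q = b \<and> \<not> read_before q r \<and> read_before q p}) \<and>
     (\<forall>r. card {q \<in> Y. T q = b \<and> read_before p q \<and> \<not> read_before r q}
        \<le> card {q \<in> Y. T q = a \<and> read_before p q \<and> \<not> read_before r q})"

text \<open>The form in which cancellation is verified for tableaux: \<open>g\<close> and \<open>h\<close> are the bracket matchings.  In
the applications they move a box one step up, down, left or right.\<close>

lemma balanced_atI:
  assumes "finite Y" and "inj_on g Y" and "inj_on h Y"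
    and before: "\<And>q. q \<in> Y \<Longrightarrow> T q = a \<Longrightarrow> read_before q p \<Longrightarrow>
      g q \<in> Y \<and> T (g q) = b \<and> read_before q (g q) \<and> read_before (g q) p"
    and after: "\<And>q. q \<in> Y \<Longrightarrow> T q = b \<Longrightarrow> read_before p q \<Longrightarrow>
      h q \<in> Y \<and> T (h q) = a \<and> read_before p (h q) \<and> read_before (h q) q"
  shows "balanced_at a b Y T p"
  unfolding balanced_at_def
proof (intro conjI allI)
  have trans: "read_before u w" if "read_before u v" "read_before v w" for u v w
    using that by (auto simp: read_before_def)
  fix r
  have "g ` {q \<in> Y. T q = a \<and> \<not> read_before q r \<and> read_before q p}
      \<subseteq> {q \<in> Y. T q = b \<and> \<not> read_before q r \<and> read_before q p}"
    using before trans by blast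
  then show "card {q \<in> Y. T q = a \<and> \<not> read_before q r \<and> read_before q p}
      \<le> card {q \<in> Y. T q = b \<and> \<not> read_before q r \<and> read_before q p}"
    using assms(1,2) by (intro card_inj_on_le[where f = g]) (auto intro: inj_on_subset)
  have "h ` {q \<in> Y. T q = b \<and> read_before p q \<and> \<not> read_before r q}
      \<subseteq> {q \<in> Y. T q = a \<and> read_before p q \<and> \<not> read_before r q}"
    using after trans by blast
  then show "card {q \<in> Y. T q = b \<and> read_before p q \<and> \<not> read_before r q}
      \<le> card {q \<in> Y. T q = a \<and> read_before p q \<and> \<not> read_before r q}"
    using assms(1,3) by (intro card_inj_on_le[where f = h]) (auto intro: inj_on_subset)
qed

lemma count_list_map_distinct:
  "distinct xs \<Longrightarrow> count_list (map f xs) a = card {x \<in> set xs. f x = a}"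
proof (induction xs)
  case (Cons x xs)
  have "{y \<in> set (x # xs). f y = a} =
      (if f x = a then insert x {y \<in> set xs. f y = a} else {y \<in> set xs. f y = a})"
    by auto
  with Cons show ?case by simp
qed simp

lemma balanced_around_reading_word:
  assumes Y: "young_diagram Y" and order: "reading_order Y = us @ p # vs"
    and bal: "balanced_at a b Y T p"
  shows "balanced_around a b (map T us) (map T vs)"
proof -
  have irrefl: "\<not> read_before q q" and asym: "read_before q r \<Longrightarrow> \<not> read_before r q" for q r
    by (auto simp: read_before_def)
  have set_Y: "Y = set us \<union> {p} \<union> set vs"
    using set_reading_order[OF Y] order by auto
  note sorted = sorted_wrt_reading_order[of Y, unfolded order]
  note dist = distinct_reading_order[of Y, unfolded order]
  show ?thesis
    unfolding balanced_around_def
  proof (intro conjI allI impI)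
    fix u1 u2 assume "map T us = u1 @ u2"
    then obtain us1 us2 where us: "us = us1 @ us2" and u2: "u2 = map T us2"
      by (auto simp: map_eq_append_conv)
    show "count_list u2 a \<le> count_list u2 b"
    proof (cases us2)
      case Nil
      then show ?thesis using u2 by simp
    next
      case (Cons r us')
      have seg: "set us2 = {q \<in> Y. \<not> read_before q r \<and> read_before q p}"
      proof -
        have "\<forall>q \<in> set us1. read_before q r" "\<forall>q \<in> set us'. read_before r q \<and> read_before q p"
            "read_before r p" "\<forall>q \<in> set vs. read_before p q"
          using sorted unfolding us Cons by (auto simp: sorted_wrt_append)
        then show ?thesis
          unfolding set_Y us Cons by (auto dest: asym simp: irrefl)
      qed
      have "count_list u2 c = card {q \<in> Y. T q = c \<and> \<not> read_before q r \<and> read_before q p}" for c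
      proof -
        have "{q \<in> set us2. T q = c} = {q \<in> Y. T q = c \<and> \<not> read_before q r \<and> read_before q p}"
          unfolding seg by blast
        then show ?thesis using count_list_map_distinct[of us2 T c] dist us u2 by simp
      qed
      then show ?thesis
        using bal[unfolded balanced_at_def, THEN conjunct1, rule_format, of r] by simp
    qed
  next
    fix v1 v2 assume "map T vs = v1 @ v2"
    then obtain vs1 vs2 where vs: "vs = vs1 @ vs2" and v1: "v1 = map T vs1"
      by (auto simp: map_eq_append_conv)
    show "count_list v1 b \<le> count_list v1 a"
    proof (cases vs1 rule: rev_cases)
      case Nil
      then show ?thesis using v1 by simp
    next
      case (snoc vs' r)
      have seg: "set vs1 = {q \<in> Y. read_before p q \<and> \<not> read_before r q}"
      proof -
        have "\<forall>q \<in> set us. read_before q p" "\<forall>q \<in> set vs'. read_before p q \<and> read_before q r"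
            "read_before p r" "\<forall>q \<in> set vs2. read_before r q"
          using sorted unfolding vs snoc by (auto simp: sorted_wrt_append)
        then show ?thesis
          unfolding set_Y vs snoc by (auto dest: asym simp: irrefl)
      qed
      have "count_list v1 c = card {q \<in> Y. T q = c \<and> read_before p q \<and> \<not> read_before r q}" for c
      proof -
        have "{q \<in> set vs1. T q = c} = {q \<in> Y. T q = c \<and> read_before p q \<and> \<not> read_before r q}"
          unfolding seg by blast
        then show ?thesis using count_list_map_distinct[of vs1 T c] dist vs v1 by simp
      qed
      then show ?thesis
        using bal[unfolded balanced_at_def, THEN conjunct2, rule_format, of r] by simp
    qed
  qed
qed

text \<open>Bounding the entries by \<open>c\<close> amounts to shrinking the alphabet to an initial segment, hence to passing
to a smaller general linear superalgebra.  The parameter \<open>c\<close> is what the main induction runs over.\<close>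

definition bounded_tableaux :: "nat \<Rightarrow> nat \<Rightarrow> letter \<Rightarrow> box set \<Rightarrow> (box \<Rightarrow> letter) set" where
  "bounded_tableaux m n c Y = {T. semistandard m n Y T \<and> (\<forall>p \<in> Y. T p \<le> c)}"

inductive arrow_at :: "box set \<Rightarrow> (box \<Rightarrow> letter) \<Rightarrow> box \<Rightarrow> letter \<Rightarrow> bool"
  for Y T p where
  Bar: "T p = Bar (k + 1) \<Longrightarrow> balanced_at (Bar (k + 1)) (Bar k) Y T p \<Longrightarrow> arrow_at Y T p (Bar k)"
| Zero: "T p = Bar 1 \<Longrightarrow> (\<And>q. q \<in> Y \<Longrightarrow> read_before q p \<Longrightarrow> T q \<noteq> Bar 1 \<and> T q \<noteq> Pos 1) \<Longrightarrow>
    arrow_at Y T p (Pos 1)"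
| Pos: "T p = Pos k \<Longrightarrow> balanced_at (Pos (k + 1)) (Pos k) Y T p \<Longrightarrow> arrow_at Y T p (Pos (k + 1))"

text \<open>Connectedness is established for fillings rather than reading words.  The rule \<open>agree\<close> is there
because fillings also have values outside \<open>Y\<close>.  The rule \<open>arrow\<close> asks for both ends to be
semistandard, so that no stability of the set of tableaux under the operators enters.\<close>

inductive linked :: "nat \<Rightarrow> nat \<Rightarrow> letter \<Rightarrow> box set \<Rightarrow> (box \<Rightarrow> letter) \<Rightarrow> (box \<Rightarrow> letter) \<Rightarrow> bool"
  for m n c Y where
  agree: "T \<in> bounded_tableaux m n c Y \<Longrightarrow> T' \<in> bounded_tableaux m n c Y \<Longrightarrow>
    (\<And>p. p \<in> Y \<Longrightarrow> T p = T' p) \<Longrightarrow> linked m n c Y T T'"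
| arrow: "T \<in> bounded_tableaux m n c Y \<Longrightarrow> T(p := x) \<in> bounded_tableaux m n c Y \<Longrightarrow>
    p \<in> Y \<Longrightarrow> arrow_at Y T p x \<Longrightarrow> linked m n c Y T (T(p := x))"
| sym: "linked m n c Y T T' \<Longrightarrow> linked m n c Y T' T"
| trans: "linked m n c Y T T' \<Longrightarrow> linked m n c Y T' T'' \<Longrightarrow> linked m n c Y T T''"

lemma arrow_at_imp_fop:
  assumes Y: "young_diagram Y" and p: "p \<in> Y"
    and T: "T \<in> bounded_tableaux m n c Y" and T': "T(p := x) \<in> bounded_tableaux m n c Y"
    and arrow: "arrow_at Y T p x"
  shows "\<exists>i \<in> indices m n.
    fop (tensor_power m n (card Y)) i (reading_word Y T) = Some (reading_word Y (T(p := x)))"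
proof -
  obtain us vs where order: "reading_order Y = us @ p # vs"
    using p set_reading_order[OF Y] by (metis split_list)
  have words: "reading_word Y T = map T us @ T p # map T vs"
      "reading_word Y (T(p := x)) = map T us @ x # map T vs"
    using distinct_reading_order[of Y] unfolding reading_word_def order by auto
  have len: "card Y = length (map T us @ T p # map T vs)"
    using length_reading_order[OF Y] unfolding order by simp
  have letters: "T p \<in> letters m n" "x \<in> letters m n"
    using T T' p by (auto simp: bounded_tableaux_def semistandard_def)
  from arrow show ?thesis
  proof cases
    case (Bar k)
    then have k: "1 \<le> k" "k < m"
      using letters by (auto simp: letters_def letters_plus_def letters_minus_def)
    have "fop (tensor_power m n (card Y)) (IBar k) (reading_word Y T) =
        Some (reading_word Y (T(p := x)))"
      using fop_IBar_balanced[OF k balanced_around_reading_word[OF Y order Bar(3)], of n]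
      unfolding len words unfolding Bar(1,2) by (simp del: tensor_power.simps)
    then show ?thesis using k by (intro bexI[of _ "IBar k"]) (auto simp: indices_def)
  next
    case Zero
    have "Bar 1 \<notin> set (map T us)" "Pos 1 \<notin> set (map T us)"
      using Zero(3) sorted_wrt_reading_order[of Y] set_reading_order[OF Y]
      unfolding order by (fastforce simp: sorted_wrt_append)+
    then have "fop (tensor_power m n (card Y)) IZero (reading_word Y T) =
        Some (reading_word Y (T(p := x)))"
      using fop_IZero_first[of "map T us" m n "map T vs"] unfolding len words unfolding Zero(1,2) by (simp del: tensor_power.simps)
    then show ?thesis by (intro bexI[of _ IZero]) (auto simp: indices_def)
  next
    case (Pos k)
    then have k: "1 \<le> k" "k < n"
      using letters by (auto simp: letters_def letters_plus_def letters_minus_def)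
    have "fop (tensor_power m n (card Y)) (IPos k) (reading_word Y T) =
        Some (reading_word Y (T(p := x)))"
      using fop_IPos_balanced[OF k balanced_around_reading_word[OF Y order Pos(3)], of m]
      unfolding len words unfolding Pos(1,2) by (simp del: tensor_power.simps)
    then show ?thesis using k by (intro bexI[of _ "IPos k"]) (auto simp: indices_def)
  qed
qed

lemma linked_imp_reachable:
  assumes "young_diagram Y" and "linked m n c Y T T'"
  shows "reading_word Y T
    \<rightarrow>\<^sup>*\<^bsub>mk_symmetric (crystal_graph (indices m n) (tableau_crystal m n Y))\<^esub> reading_word Y T'"
proof -
  let ?G = "crystal_graph (indices m n) (tableau_crystal m n Y)"
  have vert: "reading_word Y T \<in> verts ?G" if "T \<in> bounded_tableaux m n c Y" for T
    using that by (auto simp: bounded_tableaux_def crystal_graph_def tableau_crystal_def)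
  from assms(2) show ?thesis
  proof induction
    case (agree T T')
    then have "reading_word Y T = reading_word Y T'"
      using set_reading_order[OF assms(1)] by (simp add: reading_word_def)
    then show ?case using vert[OF agree(1)] by (simp add: reachable_def)
  next
    case (arrow T p x)
    from arrow_at_imp_fop[OF assms(1) arrow(3,1,2,4)] obtain i where i: "i \<in> indices m n"
      "fop (tensor_power m n (card Y)) i (reading_word Y T) = Some (reading_word Y (T(p := x)))"
      by blast
    then have "(reading_word Y T, i, reading_word Y (T(p := x))) \<in> arcs ?G"
      using vert[OF arrow(1)] by (simp add: crystal_graph_def tableau_crystal_def)
    then have "(reading_word Y T, reading_word Y (T(p := x))) \<in> parcs (mk_symmetric ?G)"
      by (force simp: mk_symmetric_def crystal_graph_def)
    from rtrancl_on_into_rtrancl_on[OF rtrancl_on_refl[OF vert[OF arrow(1)]] this vert[OF arrow(2)]]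
    show ?case by (simp only: reachable_def with_proj_simps pverts_mk_symmetric)
  next
    case (sym T T')
    from sym.IH show ?case
      by (rule symmetric_reachable[rotated]) (auto simp: symmetric_def sym_def parcs_mk_symmetric)
  next
    case (trans T T' T'')
    then show ?case unfolding reachable_def by (blast intro: rtrancl_on_trans)
  qed
qed

section \<open>Rows and columns of bounded tableaux\<close>

lemma bounded_tableaux_row:
  assumes "T \<in> bounded_tableaux m n c Y" "(i, j) \<in> Y" "(i, j') \<in> Y" "j < j'"
  shows "T (i, j) \<le> T (i, j')" and "T (i, j) = T (i, j') \<Longrightarrow> T (i, j) \<in> letters_plus m"
  using assms unfolding bounded_tableaux_def semistandard_def by blast+

lemma bounded_tableaux_column:
  assumes "T \<in> bounded_tableaux m n c Y" "(i, j) \<in> Y" "(i', j) \<in> Y" "i < i'"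
  shows "T (i, j) \<le> T (i', j)" and "T (i, j) = T (i', j) \<Longrightarrow> T (i, j) \<in> letters_minus n"
  using assms unfolding bounded_tableaux_def semistandard_def by blast+

lemma bounded_tableaux_entry:
  assumes "T \<in> bounded_tableaux m n c Y" "p \<in> Y"
  shows "T p \<in> letters m n" and "T p \<le> c"
  using assms unfolding bounded_tableaux_def semistandard_def by blast+

lemma bounded_tableauxI:
  assumes "\<And>p. p \<in> Y \<Longrightarrow> T p \<in> letters m n \<and> T p \<le> c"
    and "\<And>i j j'. (i, j) \<in> Y \<Longrightarrow> (i, j') \<in> Y \<Longrightarrow> j < j' \<Longrightarrow>
      T (i, j) \<le> T (i, j') \<and> (T (i, j) = T (i, j') \<longrightarrow> T (i, j) \<in> letters_plus m)"
    and "\<And>i i' j. (i, j) \<in> Y \<Longrightarrow> (i', j) \<in> Y \<Longrightarrow> i < i' \<Longrightarrow>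
      T (i, j) \<le> T (i', j) \<and> (T (i, j) = T (i', j) \<longrightarrow> T (i, j) \<in> letters_minus n)"
  shows "T \<in> bounded_tableaux m n c Y"
  using assms unfolding bounded_tableaux_def semistandard_def by blast

lemma bounded_tableaux_column_less:
  assumes "T \<in> bounded_tableaux m n (Bar k) Y" "(i, j) \<in> Y" "(i', j) \<in> Y" "i < i'"
  shows "T (i, j) < T (i', j)"
proof -
  have "T (i, j) \<notin> letters_minus n"
    using bounded_tableaux_entry[OF assms(1,2)]
    by (cases "T (i, j)" ) (auto simp: letters_minus_def)
  then show ?thesis
    using bounded_tableaux_column[OF assms] by (auto simp: less_le)
qed

lemma bounded_tableaux_row_Pos_less:
  assumes "T \<in> bounded_tableaux m n c Y" "(i, j) \<in> Y" "(i, j') \<in> Y" "j < j'" "T (i, j') = Pos k"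
  shows "T (i, j) < T (i, j')"
  using bounded_tableaux_row[OF assms(1-4)] assms(5) by (auto simp: less_le letters_plus_def)

lemma bounded_tableaux_row_less_Pos:
  assumes "T \<in> bounded_tableaux m n c Y" "(i, j) \<in> Y" "(i, j') \<in> Y" "j < j'" "T (i, j) = Pos k"
  shows "T (i, j) < T (i, j')"
  using bounded_tableaux_row[OF assms(1-4)] assms(5) by (auto simp: less_le letters_plus_def)

lemma bounded_tableaux_monotone:
  assumes "young_diagram Y" "T \<in> bounded_tableaux m n c Y" "(i', j') \<in> Y"
    and "1 \<le> i" "i \<le> i'" "1 \<le> j" "j \<le> j'"
  shows "T (i, j) \<le> T (i', j')"
proof -
  have mem: "(i, j) \<in> Y" "(i, j') \<in> Y"
    using young_diagram_memD[OF assms(1,3)] assms(4-) by auto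
  have "T (i, j) \<le> T (i, j')"
    using bounded_tableaux_row(1)[OF assms(2) mem] assms(7) by (cases "j = j'") auto
  also have "\<dots> \<le> T (i', j')"
    using bounded_tableaux_column(1)[OF assms(2) mem(2) assms(3)] assms(5) by (cases "i = i'") auto
  finally show ?thesis .
qed

lemma bounded_tableaux_fun_upd:
  assumes T: "T \<in> bounded_tableaux m n c Y" and x: "x \<in> letters m n" "x \<le> c"
    and "\<And>j'. (i, j') \<in> Y \<Longrightarrow> j' < j \<Longrightarrow> T (i, j') \<le> x \<and> (T (i, j') = x \<longrightarrow> x \<in> letters_plus m)"
    and "\<And>j'. (i, j') \<in> Y \<Longrightarrow> j < j' \<Longrightarrow> x \<le> T (i, j') \<and> (T (i, j') = x \<longrightarrow> x \<in> letters_plus m)"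
    and "\<And>i'. (i', j) \<in> Y \<Longrightarrow> i' < i \<Longrightarrow> T (i', j) \<le> x \<and> (T (i', j) = x \<longrightarrow> x \<in> letters_minus n)"
    and "\<And>i'. (i', j) \<in> Y \<Longrightarrow> i < i' \<Longrightarrow> x \<le> T (i', j) \<and> (T (i', j) = x \<longrightarrow> x \<in> letters_minus n)"
  shows "T((i, j) := x) \<in> bounded_tableaux m n c Y"
proof (rule bounded_tableauxI, goal_cases)
  case (1 p)
  then show ?case using bounded_tableaux_entry[OF T 1] x by simp
next
  case (2 a b b')
  then show ?case using bounded_tableaux_row[OF T 2] assms(4)[of b] assms(5)[of b'] by auto
next
  case (3 a a' b)
  then show ?case using bounded_tableaux_column[OF T 3] assms(6)[of a] assms(7)[of a'] by auto
qed

section \<open>Replacing the part of a tableau below its largest letter\<close>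

definition covers :: "nat \<Rightarrow> nat \<Rightarrow> letter \<Rightarrow> letter \<Rightarrow> bool" where
  "covers m n y x \<longleftrightarrow> y < x \<and> (\<forall>l \<in> letters m n. l < x \<longrightarrow> l \<le> y)"

text \<open>\<open>overlay x T S\<close> keeps the boxes of \<open>T\<close> that contain \<open>x\<close> and takes the remaining entries from \<open>S\<close>, and
\<open>below x Y T\<close> is the shape of the part that is replaced.\<close>

definition overlay :: "letter \<Rightarrow> (box \<Rightarrow> letter) \<Rightarrow> (box \<Rightarrow> letter) \<Rightarrow> box \<Rightarrow> letter" where
  "overlay x T S q = (if T q = x then x else S q)"

definition below :: "letter \<Rightarrow> box set \<Rightarrow> (box \<Rightarrow> letter) \<Rightarrow> box set" where
  "below x Y T = {q \<in> Y. T q \<noteq> x}"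

lemma young_diagram_below:
  assumes "young_diagram Y" "T \<in> bounded_tableaux m n x Y"
  shows "young_diagram (below x Y T)"
proof -
  have "(i', j') \<in> below x Y T"
    if "(i, j) \<in> below x Y T" "1 \<le> i'" "i' \<le> i" "1 \<le> j'" "j' \<le> j" for i j i' j'
    using that bounded_tableaux_monotone[OF assms, of i j i' j'] young_diagram_memD(3)[OF assms(1), of i j i' j']
      bounded_tableaux_entry[OF assms(2), of "(i, j)"]
    by (auto simp: below_def)
  moreover have "finite (below x Y T)" "below x Y T \<subseteq> {1..} \<times> {1..}"
    using assms(1) unfolding young_diagram_def below_def by auto
  ultimately show ?thesis unfolding young_diagram_def by blast
qed

lemma bounded_tableaux_below:
  assumes "covers m n y x" "T \<in> bounded_tableaux m n x Y"
  shows "T \<in> bounded_tableaux m n y (below x Y T)"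
proof (rule bounded_tableauxI, goal_cases)
  case (1 p)
  then have "p \<in> Y" "T p \<noteq> x" by (auto simp: below_def)
  then show ?case
    using bounded_tableaux_entry[OF assms(2)] assms(1) by (auto simp: covers_def less_le)
next
  case (2 i j j')
  then show ?case using bounded_tableaux_row[OF assms(2)] by (auto simp: below_def)
next
  case (3 i i' j)
  then show ?case using bounded_tableaux_column[OF assms(2)] by (auto simp: below_def)
qed

lemma overlay_bounded_tableaux:
  assumes "y < x" and T: "T \<in> bounded_tableaux m n x Y" and S: "S \<in> bounded_tableaux m n y (below x Y T)"
    and Y: "young_diagram Y"
  shows "overlay x T S \<in> bounded_tableaux m n x Y"
proof (rule bounded_tableauxI, goal_cases)
  case (1 p)
  then show ?case
    using bounded_tableaux_entry[OF T 1] bounded_tableaux_entry[OF S, of p] \<open>y < x\<close>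
    by (auto simp: overlay_def below_def)
next
  case (2 i j j')
  then have "T (i, j) = x \<Longrightarrow> T (i, j') = x"
    using bounded_tableaux_row(1)[OF T 2] bounded_tableaux_entry(2)[OF T 2(2)] by simp
  then show ?case
    using 2 bounded_tableaux_row[OF T 2] bounded_tableaux_row[OF S, of i j j']
      bounded_tableaux_entry(2)[OF S, of "(i, j)"] \<open>y < x\<close>
    by (auto simp: overlay_def below_def)
next
  case (3 i i' j)
  then have "T (i, j) = x \<Longrightarrow> T (i', j) = x"
    using bounded_tableaux_column(1)[OF T 3] bounded_tableaux_entry(2)[OF T 3(2)] by simp
  then show ?case
    using 3 bounded_tableaux_column[OF T 3] bounded_tableaux_column[OF S, of i j i']
      bounded_tableaux_entry(2)[OF S, of "(i, j)"] \<open>y < x\<close>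
    by (auto simp: overlay_def below_def)
qed

lemma balanced_at_overlay:
  assumes "balanced_at a b (below x Y T) S p" "a \<noteq> x" "b \<noteq> x"
  shows "balanced_at a b Y (overlay x T S) p"
proof -
  have "{q \<in> Y. overlay x T S q = c \<and> R q} = {q \<in> below x Y T. S q = c \<and> R q}"
    if "c \<noteq> x" for c R
    using that by (auto simp: overlay_def below_def)
  then show ?thesis using assms unfolding balanced_at_def by simp
qed

text \<open>The operators that move letters smaller than \<open>x\<close> do not see the boxes filled with \<open>x\<close>; this is why
arrows on the smaller shape are arrows on \<open>Y\<close>.\<close>

lemma arrow_at_overlay:
  assumes "arrow_at (below x Y T) S p l" "p \<in> below x Y T" "S p < x" "l < x"
  shows "arrow_at Y (overlay x T S) p l"
proof -
  have p: "overlay x T S p = S p" using assms(2) by (simp add: overlay_def below_def)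
  from assms(1) show ?thesis
  proof cases
    case (Bar k)
    then show ?thesis
      using assms(3,4) p balanced_at_overlay[of _ _ x Y T S p] by (auto intro!: arrow_at.Bar)
  next
    case Zero
    have "overlay x T S q \<noteq> Bar 1 \<and> overlay x T S q \<noteq> Pos 1" if "q \<in> Y" "read_before q p" for q
      using Zero(3)[of q] that assms(3,4) Zero(1,2) by (auto simp: overlay_def below_def)
    then show ?thesis unfolding Zero(1) using Zero(2) p by (intro arrow_at.Zero) auto
  next
    case (Pos k)
    then show ?thesis
      using assms(3,4) p balanced_at_overlay[of _ _ x Y T S p] arrow_at.Pos[of "overlay x T S" p k Y]
      by auto
  qed
qed

lemma linked_bounded_tableaux:
  "linked m n c Y T T' \<Longrightarrow> T \<in> bounded_tableaux m n c Y \<and> T' \<in> bounded_tableaux m n c Y"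
  by (induction rule: linked.induct) blast+

lemma linked_overlay:
  assumes "y < x" and T: "T \<in> bounded_tableaux m n x Y" and Y: "young_diagram Y"
    and "linked m n y (below x Y T) S S'"
  shows "linked m n x Y (overlay x T S) (overlay x T S')"
  using assms(4)
proof induction
  case (agree S S')
  have "overlay x T S p = overlay x T S' p" if "p \<in> Y" for p
    using agree(3) that by (simp add: overlay_def below_def)
  then show ?case
    using agree(1,2) overlay_bounded_tableaux[OF assms(1) T _ Y] by (intro linked.agree) blast+
next
  case (arrow S p l)
  have upd: "overlay x T (S(p := l)) = (overlay x T S)(p := l)"
    using arrow(3) by (auto simp: overlay_def below_def)
  have "S p \<le> y" "l \<le> y"
    using bounded_tableaux_entry(2)[OF arrow(1,3)] bounded_tableaux_entry(2)[OF arrow(2,3)] by auto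
  then have "arrow_at Y (overlay x T S) p l"
    using arrow_at_overlay[OF arrow(4,3)] assms(1) by simp
  moreover have "p \<in> Y" using arrow(3) by (simp add: below_def)
  ultimately show ?case
    using overlay_bounded_tableaux[OF assms(1) T arrow(1) Y]
      overlay_bounded_tableaux[OF assms(1) T arrow(2) Y]
    unfolding upd by (intro linked.arrow)
next
  case (sym S S')
  then show ?case by (blast intro: linked.sym)
next
  case (trans S S' S'')
  then show ?case by (blast intro: linked.trans)
qed

definition all_linked :: "nat \<Rightarrow> nat \<Rightarrow> letter \<Rightarrow> bool" where
  "all_linked m n c \<longleftrightarrow> (\<forall>Y. young_diagram Y \<longrightarrow>
     (\<forall>T \<in> bounded_tableaux m n c Y. \<forall>T' \<in> bounded_tableaux m n c Y. linked m n c Y T T'))"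

lemma linked_to_overlay:
  assumes "all_linked m n y" "covers m n y x" "young_diagram Y"
    and T: "T \<in> bounded_tableaux m n x Y" and S: "S \<in> bounded_tableaux m n y (below x Y T)"
  shows "linked m n x Y T (overlay x T S)"
proof -
  have "linked m n y (below x Y T) T S"
    using assms(1) young_diagram_below[OF assms(3) T] bounded_tableaux_below[OF assms(2) T] S
    unfolding all_linked_def by blast
  moreover have "overlay x T T = T" by (auto simp: overlay_def)
  moreover have "y < x" using assms(2) by (simp add: covers_def)
  ultimately show ?thesis using linked_overlay[OF _ T assms(3)] by metis
qed

text \<open>The inductive step, reduced to a normal form: if every tableau is linked to one whose largest letter
\<open>x\<close> occupies a set of boxes \<open>P Y\<close> that depends only on the shape, then two tableaux in normal form
differ only below \<open>x\<close>, where the induction hypothesis links them.\<close>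

lemma all_linked_step:
  assumes y: "all_linked m n y" "covers m n y x"
    and canonical: "\<And>Y T. young_diagram Y \<Longrightarrow> T \<in> bounded_tableaux m n x Y \<Longrightarrow>
      \<exists>T'. linked m n x Y T T' \<and> (\<forall>q \<in> Y. T' q = x \<longleftrightarrow> P Y q)"
  shows "all_linked m n x"
  unfolding all_linked_def
proof (intro allI impI ballI)
  fix Y T1 T2
  assume Y: "young_diagram Y" and "T1 \<in> bounded_tableaux m n x Y" "T2 \<in> bounded_tableaux m n x Y"
  then obtain T1' T2' where
    T1': "linked m n x Y T1 T1'" "\<forall>q \<in> Y. T1' q = x \<longleftrightarrow> P Y q" and
    T2': "linked m n x Y T2 T2'" "\<forall>q \<in> Y. T2' q = x \<longleftrightarrow> P Y q"
    using canonical by meson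
  note mem = linked_bounded_tableaux[OF T1'(1), THEN conjunct2]
    linked_bounded_tableaux[OF T2'(1), THEN conjunct2]
  have "below x Y T1' = below x Y T2'" using T1'(2) T2'(2) by (auto simp: below_def)
  then have S: "T2' \<in> bounded_tableaux m n y (below x Y T1')"
    using bounded_tableaux_below[OF y(2) mem(2)] by simp
  have "linked m n x Y T1' (overlay x T1' T2')"
    by (rule linked_to_overlay[OF y Y mem(1) S])
  moreover have "linked m n x Y (overlay x T1' T2') T2'"
    using overlay_bounded_tableaux[OF _ mem(1) S Y] y(2) mem(2) T1'(2) T2'(2)
    by (intro linked.agree) (auto simp: overlay_def covers_def)
  ultimately show "linked m n x Y T1 T2"
    using T1'(1) T2'(1) by (meson linked.sym linked.trans)
qed

lemma covers_Bar: "covers m n (Bar (k + 1)) (Bar k)"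
  unfolding covers_def
proof (intro conjI ballI impI)
  fix l assume "l < Bar k"
  then show "l \<le> Bar (k + 1)" by (cases l) (auto simp: less_le_not_le)
qed (simp add: less_le_not_le)

lemma covers_Zero: "covers m n (Bar 1) (Pos 1)"
  unfolding covers_def
proof (intro conjI ballI impI)
  fix l assume "l < Pos 1" "l \<in> letters m n"
  then show "l \<le> Bar 1"
    by (cases l) (auto simp: less_le_not_le letters_def letters_plus_def letters_minus_def)
qed (simp add: less_le_not_le)

lemma covers_Pos: "covers m n (Pos k) (Pos (k + 1))"
  unfolding covers_def
proof (intro conjI ballI impI)
  fix l assume "l < Pos (k + 1)"
  then show "l \<le> Pos k" by (cases l) (auto simp: less_le_not_le)
qed (simp add: less_le_not_le)

lemma covers_between:
  assumes "covers m n y x" "l \<in> letters m n" "y < l" "l \<le> x"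
  shows "l = x"
  using assms unfolding covers_def by (metis leD le_less)

lemma finite_young_diagram: "young_diagram Y \<Longrightarrow> finite Y"
  by (simp add: young_diagram_def)

section \<open>Moving a letter to the ends of all columns or rows\<close>

lemma finite_arg_max:
  fixes f :: "'a \<Rightarrow> 'b :: linorder"
  assumes "finite B" "B \<noteq> {}"
  obtains p where "p \<in> B" "\<And>q. q \<in> B \<Longrightarrow> f q \<le> f p"
proof -
  have "Max (f ` B) \<in> f ` B" using assms by (intro Max_in) auto
  then obtain p where "p \<in> B" "Max (f ` B) = f p" by blast
  then show ?thesis using that[of p] Max_ge[of "f ` B"] assms by auto
qed

text \<open>Both this lemma and the next serve to choose, below the largest letter \<open>x\<close> of the ambient tableau, a
filling in which the predecessor of \<open>x\<close> occurs as often as possible, so that the operator that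
creates \<open>x\<close> has material to act on.\<close>

lemma lower_column_ends:
  assumes Z: "young_diagram Z" and S: "S \<in> bounded_tableaux m n (Bar k) Z" and k: "Bar k \<in> letters m n"
  shows "(\<lambda>(i, j). if (i + 1, j) \<in> Z then S (i, j) else Bar k) \<in> bounded_tableaux m n (Bar k) Z"
proof (rule bounded_tableauxI, goal_cases)
  case (1 p)
  then show ?case using bounded_tableaux_entry[OF S 1] k by (auto split: prod.splits)
next
  case (2 i j j')
  have Bar: "l \<in> letters_plus m" if "l \<in> letters m n" "l \<le> Bar k" for l
    using that by (cases l) (auto simp: letters_def letters_minus_def)
  have "(i + 1, j) \<in> Z" if "(i + 1, j') \<in> Z"
    using young_diagram_memD[OF Z that] young_diagram_memD[OF Z 2(1)] 2(3) by simp
  then show ?case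
    using bounded_tableaux_row[OF S 2] bounded_tableaux_entry[OF S 2(1)] Bar k by auto
next
  case (3 i i' j)
  have "(i + 1, j) \<in> Z"
    using young_diagram_memD[OF Z 3(2)] 3(3) by simp
  moreover have "S (i, j) < S (i', j)" by (rule bounded_tableaux_column_less[OF S 3])
  moreover have "S (i', j) \<le> Bar k" using bounded_tableaux_entry[OF S 3(2)] by simp
  ultimately show ?case by auto
qed

lemma lower_row_ends:
  assumes Z: "young_diagram Z" and S: "S \<in> bounded_tableaux m n (Pos k) Z" and k: "Pos k \<in> letters m n"
  shows "(\<lambda>(i, j). if (i, j + 1) \<in> Z then S (i, j) else Pos k) \<in> bounded_tableaux m n (Pos k) Z"
proof (rule bounded_tableauxI, goal_cases)
  case (1 p)
  then show ?case using bounded_tableaux_entry[OF S 1] k by (auto split: prod.splits)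
next
  case (2 i j j')
  have "(i, j + 1) \<in> Z"
    using young_diagram_memD[OF Z 2(2)] 2(3) by simp
  moreover have "S (i, j) < Pos k"
    using bounded_tableaux_row_less_Pos[OF S 2, of k] bounded_tableaux_entry(2)[OF S 2(1)]
      bounded_tableaux_entry(2)[OF S 2(2)] by (auto simp: less_le)
  ultimately show ?case using bounded_tableaux_row[OF S 2] by auto
next
  case (3 i i' j)
  have "(i, j + 1) \<in> Z" if "(i', j + 1) \<in> Z"
    using young_diagram_memD[OF Z that] young_diagram_memD[OF Z 3(1)] 3(3) by simp
  moreover have "Pos k \<in> letters_minus n"
    using k by (auto simp: letters_def letters_plus_def)
  ultimately show ?case
    using bounded_tableaux_column[OF S 3] bounded_tableaux_entry(2)[OF S 3(1)] by auto
qed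

text \<open>Write $y=\overline{k+1}$ and $x=\overline k$.  By \<open>lowered\<close>, a column
that ends with \<open>x\<close> has length one or has \<open>y\<close> right
above that \<open>x\<close>, and then the two cancel; a column that does not end with \<open>x\<close> contributes a single \<open>y\<close>.
Columns of length one that contain \<open>x\<close> lie to the right of all columns without \<open>x\<close>, so they are read
earlier, and an earlier \<open>x\<close> does not cancel against a later \<open>y\<close>.  Hence
$\tilde f_{\overline k}$ acts on the rightmost column end that is not yet \<open>x\<close>.\<close>

lemma raise_column_end:
  assumes Y: "young_diagram Y" and T: "T \<in> bounded_tableaux m n (Bar k) Y"
    and k: "Bar k \<in> letters m n"
    and lowered: "\<And>a b. (a, b) \<in> below (Bar k) Y T \<Longrightarrow> (a + 1, b) \<notin> below (Bar k) Y T \<Longrightarrow>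
      T (a, b) = Bar (k + 1)"
    and p: "(i, j) \<in> Y" "(i + 1, j) \<notin> Y" "T (i, j) \<noteq> Bar k"
    and rightmost: "\<And>a b. (a, b) \<in> Y \<Longrightarrow> (a + 1, b) \<notin> Y \<Longrightarrow> j < b \<Longrightarrow> T (a, b) = Bar k"
  shows "T((i, j) := Bar k) \<in> bounded_tableaux m n (Bar k) Y" and "arrow_at Y T (i, j) (Bar k)"
proof -
  have less: "Bar (k + 1) < Bar k" by (simp add: less_le_not_le)
  note covers = covers_Bar[of m n k]
  have Tp: "T (i, j) = Bar (k + 1)"
    using p by (intro lowered) (auto simp: below_def)
  have Bar_plus: "Bar k \<in> letters_plus m" using k by (auto simp: letters_def letters_minus_def)
  show "T((i, j) := Bar k) \<in> bounded_tableaux m n (Bar k) Y"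
  proof (rule bounded_tableaux_fun_upd[OF T k], goal_cases)
    case (2 j')
    then show ?case using bounded_tableaux_entry(2)[OF T 2(1)] Bar_plus by simp
  next
    case (3 j')
    have "(i + 1, j') \<notin> Y"
      using young_diagram_memD(3)[OF Y, of "i + 1" j' "i + 1" j] young_diagram_memD(2)[OF Y p(1)] p(2) 3
      by auto
    then show ?case using rightmost[OF 3(1)] 3 Bar_plus by simp
  next
    case (4 i')
    then show ?case using bounded_tableaux_column_less[OF T 4(1) p(1)] Tp less by auto
  next
    case (5 i')
    then have "(i + 1, j) \<in> Y" using young_diagram_memD(3)[OF Y 5(1), of "i + 1" j]
      young_diagram_memD(2)[OF Y p(1)] by simp
    then show ?case using p(2) by simp
  qed simp
  have "balanced_at (Bar (k + 1)) (Bar k) Y T (i, j)"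
  proof (rule balanced_atI[where g = "\<lambda>(a, b). (a + 1, b)" and h = "\<lambda>(a, b). (a - 1, b)"])
    show "finite Y" by (rule finite_young_diagram[OF Y])
    show "inj_on (\<lambda>(a, b). (a + 1, b)) Y" by (auto simp: inj_on_def)
    show "inj_on (\<lambda>(a, b). (a - 1, b)) Y"
    proof (rule inj_onI)
      fix q q' assume "q \<in> Y" "q' \<in> Y" and "(case q of (a, b) \<Rightarrow> (a - 1, b)) = (case q' of (a, b) \<Rightarrow> (a - 1, b))"
      then show "q = q'"
        using young_diagram_memD(1)[OF Y, of "fst q" "snd q"]
          young_diagram_memD(1)[OF Y, of "fst q'" "snd q'"]
        by (cases q; cases q') auto
    qed
  next
    fix q assume q: "q \<in> Y" "T q = Bar (k + 1)" "read_before q (i, j)"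
    obtain a b where ab: "q = (a, b)" by (cases q)
    have "b \<noteq> j"
      using bounded_tableaux_column_less[OF T _ p(1), of a] q Tp by (auto simp: ab read_before_def)
    then have b: "j < b" using q(3) by (auto simp: ab read_before_def)
    then have mem: "(a + 1, b) \<in> Y" using rightmost[of a b] q(1,2) less by (auto simp: ab)
    have "T (a, b) < T (a + 1, b)"
      using bounded_tableaux_column_less[OF T _ mem, of a] q(1) by (simp add: ab)
    then have "T (a + 1, b) = Bar k"
      using covers_between[OF covers bounded_tableaux_entry(1)[OF T mem]]
        bounded_tableaux_entry(2)[OF T mem] q(2) by (simp add: ab)
    then show "(case q of (a, b) \<Rightarrow> (a + 1, b)) \<in> Y \<and> T (case q of (a, b) \<Rightarrow> (a + 1, b)) = Bar k \<and>
        read_before q (case q of (a, b) \<Rightarrow> (a + 1, b)) \<and>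
        read_before (case q of (a, b) \<Rightarrow> (a + 1, b)) (i, j)"
      using mem b by (auto simp: ab read_before_def)
  next
    fix q assume q: "q \<in> Y" "T q = Bar k" "read_before (i, j) q"
    obtain a b where ab: "q = (a, b)" by (cases q)
    have a1: "1 \<le> a" using young_diagram_memD(1)[OF Y] q(1) by (auto simp: ab)
    have "b \<noteq> j"
      using young_diagram_memD(3)[OF Y, of a j "i + 1" j] young_diagram_memD(2)[OF Y p(1)] p(2) q
      by (auto simp: ab read_before_def)
    then have b: "b < j" using q(3) by (auto simp: ab read_before_def)
    \<comment> \<open>A $\overline k$ on top of a column further left would force an entry $\overline k$ at the end of column \<open>j\<close>.\<close>
    have "a \<noteq> 1"
    proof
      assume "a = 1"
      then have "T (1, b) \<le> T (i, j)"
        using bounded_tableaux_monotone[OF Y T p(1), of 1 b] young_diagram_memD[OF Y, of a b]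
          young_diagram_memD(1)[OF Y p(1)] q(1) b by (simp add: ab)
      then show False using q(2) Tp less \<open>a = 1\<close> by (simp add: ab)
    qed
    then have a: "2 \<le> a" using a1 by simp
    have mem: "(a - 1, b) \<in> Y"
      using young_diagram_memD[OF Y, of a b] q(1) a by (simp add: ab)
    have "T (a - 1, b) < Bar k"
      using bounded_tableaux_column_less[OF T mem, of a] q(1,2) a by (simp add: ab)
    then have "T (a - 1, b) = Bar (k + 1)"
      using lowered[of "a - 1" b] mem q(2) a by (auto simp: ab below_def)
    then show "(case q of (a, b) \<Rightarrow> (a - 1, b)) \<in> Y \<and>
        T (case q of (a, b) \<Rightarrow> (a - 1, b)) = Bar (k + 1) \<and>
        read_before (i, j) (case q of (a, b) \<Rightarrow> (a - 1, b)) \<and>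
        read_before (case q of (a, b) \<Rightarrow> (a - 1, b)) q"
      using mem b a by (auto simp: ab read_before_def)
  qed
  then show "arrow_at Y T (i, j) (Bar k)" by (rule arrow_at.Bar[of T, OF Tp])
qed

text \<open>The transposed argument, with $y=k$ and $x=k+1$: an \<open>x\<close> cancels against the \<open>y\<close> to its left, rows of
length one that contain \<open>x\<close> lie below all rows without \<open>x\<close>, and $\tilde f_k$ acts on the bottommost
row end that is not yet \<open>x\<close>.  The column reading is harder on this argument than on the previous
one, because partners now lie in adjacent columns; monotonicity along columns keeps them on the same
side of the distinguished box.\<close>

lemma raise_row_end:
  assumes Y: "young_diagram Y" and T: "T \<in> bounded_tableaux m n (Pos (k + 1)) Y"
    and k: "1 \<le> k" "Pos (k + 1) \<in> letters m n"
    and lowered: "\<And>a b. (a, b) \<in> below (Pos (k + 1)) Y T \<Longrightarrow>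
      (a, b + 1) \<notin> below (Pos (k + 1)) Y T \<Longrightarrow> T (a, b) = Pos k"
    and p: "(i, j) \<in> Y" "(i, j + 1) \<notin> Y" "T (i, j) \<noteq> Pos (k + 1)"
    and bottommost: "\<And>a b. (a, b) \<in> Y \<Longrightarrow> (a, b + 1) \<notin> Y \<Longrightarrow> i < a \<Longrightarrow> T (a, b) = Pos (k + 1)"
  shows "T((i, j) := Pos (k + 1)) \<in> bounded_tableaux m n (Pos (k + 1)) Y"
    and "arrow_at Y T (i, j) (Pos (k + 1))"
proof -
  have less: "Pos k < Pos (k + 1)" by (simp add: less_le_not_le)
  note covers = covers_Pos[of m n k]
  have Tp: "T (i, j) = Pos k"
    using p by (intro lowered) (auto simp: below_def)
  have Pos_minus: "Pos (k + 1) \<in> letters_minus n" using k by (auto simp: letters_def letters_plus_def)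
  show "T((i, j) := Pos (k + 1)) \<in> bounded_tableaux m n (Pos (k + 1)) Y"
  proof (rule bounded_tableaux_fun_upd[OF T k(2)], goal_cases)
    case (2 j')
    then show ?case using bounded_tableaux_row_Pos_less[OF T 2(1) p(1) 2(2) Tp] Tp less by auto
  next
    case (3 j')
    then have "(i, j + 1) \<in> Y" using young_diagram_memD(3)[OF Y 3(1), of i "j + 1"]
      young_diagram_memD(1)[OF Y p(1)] by simp
    then show ?case using p(2) by simp
  next
    case (4 i')
    then show ?case using bounded_tableaux_entry(2)[OF T 4(1)] Pos_minus by simp
  next
    case (5 i')
    have "(i', j + 1) \<notin> Y"
      using young_diagram_memD(3)[OF Y, of i' "j + 1" i "j + 1"] young_diagram_memD(1)[OF Y p(1)] p(2) 5
      by auto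
    then show ?case using bottommost[OF 5(1)] 5 Pos_minus by simp
  qed simp
  have "balanced_at (Pos (k + 1)) (Pos k) Y T (i, j)"
  proof (rule balanced_atI[where g = "\<lambda>(a, b). (a, b - 1)" and h = "\<lambda>(a, b). (a, b + 1)"])
    show "finite Y" by (rule finite_young_diagram[OF Y])
    show "inj_on (\<lambda>(a, b). (a, b + 1)) Y" by (auto simp: inj_on_def)
    show "inj_on (\<lambda>(a, b). (a, b - 1)) Y"
    proof (rule inj_onI)
      fix q q' assume "q \<in> Y" "q' \<in> Y" and "(case q of (a, b) \<Rightarrow> (a, b - 1)) = (case q' of (a, b) \<Rightarrow> (a, b - 1))"
      then show "q = q'"
        using young_diagram_memD(2)[OF Y, of "fst q" "snd q"]
          young_diagram_memD(2)[OF Y, of "fst q'" "snd q'"]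
        by (cases q; cases q') auto
    qed
  next
    fix q assume q: "q \<in> Y" "T q = Pos (k + 1)" "read_before q (i, j)"
    obtain a b where ab: "q = (a, b)" by (cases q)
    have "b \<noteq> j"
      using bounded_tableaux_column(1)[OF T _ p(1), of a] q Tp less by (auto simp: ab read_before_def)
    then have b: "j < b" using q(3) by (auto simp: ab read_before_def)
    have j: "1 \<le> j" by (rule young_diagram_memD(2)[OF Y p(1)])
    have "a < i"
    proof (rule ccontr)
      assume "\<not> a < i"
      then have "(i, j + 1) \<in> Y"
        using young_diagram_memD(3)[OF Y, of a b i "j + 1"] young_diagram_memD(1)[OF Y p(1)] q(1) b
        by (simp add: ab)
      then show False using p(2) by simp
    qed
    have mem: "(a, b - 1) \<in> Y"
      using young_diagram_memD[OF Y, of a b] q(1) b j by (simp add: ab)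
    have "T (a, b - 1) < Pos (k + 1)"
      using bounded_tableaux_row_Pos_less[OF T mem, of b "k + 1"] q(1,2) b by (simp add: ab)
    then have "T (a, b - 1) = Pos k"
      using lowered[of a "b - 1"] mem q(2) b by (auto simp: ab below_def)
    then show "(case q of (a, b) \<Rightarrow> (a, b - 1)) \<in> Y \<and>
        T (case q of (a, b) \<Rightarrow> (a, b - 1)) = Pos k \<and>
        read_before q (case q of (a, b) \<Rightarrow> (a, b - 1)) \<and>
        read_before (case q of (a, b) \<Rightarrow> (a, b - 1)) (i, j)"
      using mem b \<open>a < i\<close> by (auto simp: ab read_before_def)
  next
    fix q assume q: "q \<in> Y" "T q = Pos k" "read_before (i, j) q"
    obtain a b where ab: "q = (a, b)" by (cases q)
    have ab1: "1 \<le> a" "1 \<le> b" using young_diagram_memD(1,2)[OF Y, of a b] q(1) by (simp_all add: ab)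
    have bj: "b < j \<or> b = j \<and> i < a" using q(3) by (auto simp: ab read_before_def)
    have mem: "(a, b + 1) \<in> Y"
    proof (cases "a \<le> i")
      case True
      then show ?thesis
        using young_diagram_memD(3)[OF Y p(1), of a "b + 1"] ab1 bj by auto
    next
      case False
      then show ?thesis using bottommost[of a b] q(1,2) by (auto simp: ab)
    qed
    have Tr: "T (a, b + 1) = Pos (k + 1)"
      using covers_between[OF covers bounded_tableaux_entry(1)[OF T mem]]
        bounded_tableaux_entry(2)[OF T mem] bounded_tableaux_row_less_Pos[OF T _ mem, of b k] q(1,2) by (simp add: ab)
    have "i < a"
    proof (rule ccontr)
      assume "\<not> i < a"
      then have "T (a, b + 1) \<le> T (i, j)"
        using bounded_tableaux_monotone[OF Y T p(1), of a "b + 1"] ab1 bj by auto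
      then show False using Tr Tp less by simp
    qed
    have "b \<noteq> j"
      using young_diagram_memD(3)[OF Y mem, of i "j + 1"] young_diagram_memD(1)[OF Y p(1)] p(2) \<open>i < a\<close>
      by auto
    then show "(case q of (a, b) \<Rightarrow> (a, b + 1)) \<in> Y \<and>
        T (case q of (a, b) \<Rightarrow> (a, b + 1)) = Pos (k + 1) \<and>
        read_before (i, j) (case q of (a, b) \<Rightarrow> (a, b + 1)) \<and>
        read_before (case q of (a, b) \<Rightarrow> (a, b + 1)) q"
      using mem Tr bj \<open>i < a\<close> by (auto simp: ab read_before_def)
  qed
  then show "arrow_at Y T (i, j) (Pos (k + 1))" by (rule arrow_at.Pos[of T, OF Tp])
qed

text \<open>Lowering the column ends of the part below $\overline k$ and then applying $\tilde f_{\overline k}$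
enlarges the set of boxes that contain $\overline k$, until it consists of all column ends.\<close>

lemma linked_to_full_columns:
  assumes y: "all_linked m n (Bar (k + 1))" and k: "1 \<le> k" "k < m"
    and Y: "young_diagram Y" and "T \<in> bounded_tableaux m n (Bar k) Y"
  shows "\<exists>T'. linked m n (Bar k) Y T T' \<and>
    (\<forall>q \<in> Y. T' q = Bar k \<longleftrightarrow> (fst q + 1, snd q) \<notin> Y)"
  using assms(5)
proof (induction "card (below (Bar k) Y T)" arbitrary: T rule: less_induct)
  case less
  let ?Z = "below (Bar k) Y T"
  have letters: "Bar k \<in> letters m n" "Bar (k + 1) \<in> letters m n"
    using k by (auto simp: letters_def letters_plus_def)
  define T1 where "T1 = overlay (Bar k) T (\<lambda>(i, j). if (i + 1, j) \<in> ?Z then T (i, j) else Bar (k + 1))"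
  have Z: "young_diagram ?Z" by (rule young_diagram_below[OF Y less.prems])
  have S: "(\<lambda>(i, j). if (i + 1, j) \<in> ?Z then T (i, j) else Bar (k + 1))
      \<in> bounded_tableaux m n (Bar (k + 1)) ?Z"
    by (rule lower_column_ends[OF Z bounded_tableaux_below[OF covers_Bar less.prems] letters(2)])
  have T1: "linked m n (Bar k) Y T T1"
    unfolding T1_def by (rule linked_to_overlay[OF y covers_Bar Y less.prems S])
  note T1_mem = linked_bounded_tableaux[OF T1, THEN conjunct2]
  have Z1: "below (Bar k) Y T1 = ?Z"
    by (auto simp: T1_def overlay_def below_def split: if_splits)
  have lowered: "T1 (a, b) = Bar (k + 1)" if "(a, b) \<in> ?Z" "(a + 1, b) \<notin> ?Z" for a b
    using that by (auto simp: T1_def overlay_def below_def)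
  define B where "B = {q \<in> Y. (fst q + 1, snd q) \<notin> Y \<and> T1 q \<noteq> Bar k}"
  show ?case
  proof (cases "B = {}")
    case True
    have "T1 q = Bar k \<longleftrightarrow> (fst q + 1, snd q) \<notin> Y" if q: "q \<in> Y" for q
    proof
      assume "T1 q = Bar k"
      then show "(fst q + 1, snd q) \<notin> Y"
        using bounded_tableaux_column_less[OF T1_mem, of "fst q" "snd q" "fst q + 1"] q
          bounded_tableaux_entry(2)[OF T1_mem, of "(fst q + 1, snd q)"] by auto
    next
      assume "(fst q + 1, snd q) \<notin> Y"
      moreover have "q \<notin> B" using True by simp
      ultimately show "T1 q = Bar k" using q by (simp add: B_def)
    qed
    then show ?thesis using T1 by blast
  next
    case False
    have "finite B" using finite_young_diagram[OF Y] by (simp add: B_def)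
    then obtain p where "p \<in> B" and max: "\<And>q. q \<in> B \<Longrightarrow> snd q \<le> snd p"
      using finite_arg_max[OF _ False, of snd] by blast
    then obtain i j where p: "(i, j) \<in> Y" "(i + 1, j) \<notin> Y" "T1 (i, j) \<noteq> Bar k" and ij: "p = (i, j)"
      by (cases p) (auto simp: B_def)
    have rightmost: "T1 (a, b) = Bar k" if "(a, b) \<in> Y" "(a + 1, b) \<notin> Y" "j < b" for a b
      using max[of "(a, b)"] that by (force simp: B_def ij)
    define T2 where "T2 = T1((i, j) := Bar k)"
    have "T2 \<in> bounded_tableaux m n (Bar k) Y" and "arrow_at Y T1 (i, j) (Bar k)"
      using raise_column_end[OF Y T1_mem letters(1) _ p] lowered rightmost unfolding Z1 T2_def by blast+
    then have T2: "linked m n (Bar k) Y T1 T2"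
      using linked.arrow[OF T1_mem _ p(1)] by (simp only: T2_def)
    have "below (Bar k) Y T2 = ?Z - {(i, j)}"
      unfolding Z1[symmetric] by (auto simp: T2_def below_def)
    moreover have "(i, j) \<in> ?Z" using p unfolding Z1[symmetric] by (simp add: below_def)
    ultimately have "card (below (Bar k) Y T2) < card ?Z"
      using finite_young_diagram[OF Z] by (simp only: card_Diff1_less)
    from less.hyps[OF this linked_bounded_tableaux[OF T2, THEN conjunct2]]
    obtain T' where "linked m n (Bar k) Y T2 T'" "\<forall>q \<in> Y. T' q = Bar k \<longleftrightarrow> (fst q + 1, snd q) \<notin> Y" by blast
    then show ?thesis using linked.trans[OF linked.trans[OF T1 T2]] by blast
  qed
qed

lemma linked_to_full_rows:
  assumes y: "all_linked m n (Pos k)" and k: "1 \<le> k" "k < n"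
    and Y: "young_diagram Y" and "T \<in> bounded_tableaux m n (Pos (k + 1)) Y"
  shows "\<exists>T'. linked m n (Pos (k + 1)) Y T T' \<and>
    (\<forall>q \<in> Y. T' q = Pos (k + 1) \<longleftrightarrow> (fst q, snd q + 1) \<notin> Y)"
  using assms(5)
proof (induction "card (below (Pos (k + 1)) Y T)" arbitrary: T rule: less_induct)
  case less
  let ?Z = "below (Pos (k + 1)) Y T"
  have letters: "Pos k \<in> letters m n" "Pos (k + 1) \<in> letters m n"
    using k by (auto simp: letters_def letters_minus_def)
  define T1 where "T1 = overlay (Pos (k + 1)) T (\<lambda>(i, j). if (i, j + 1) \<in> ?Z then T (i, j) else Pos k)"
  have Z: "young_diagram ?Z" by (rule young_diagram_below[OF Y less.prems])
  have S: "(\<lambda>(i, j). if (i, j + 1) \<in> ?Z then T (i, j) else Pos k) \<in> bounded_tableaux m n (Pos k) ?Z"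
    by (rule lower_row_ends[OF Z bounded_tableaux_below[OF covers_Pos less.prems] letters(1)])
  have T1: "linked m n (Pos (k + 1)) Y T T1"
    unfolding T1_def by (rule linked_to_overlay[OF y covers_Pos Y less.prems S])
  note T1_mem = linked_bounded_tableaux[OF T1, THEN conjunct2]
  have Z1: "below (Pos (k + 1)) Y T1 = ?Z"
    by (auto simp: T1_def overlay_def below_def split: if_splits)
  have lowered: "T1 (a, b) = Pos k" if "(a, b) \<in> ?Z" "(a, b + 1) \<notin> ?Z" for a b
    using that by (auto simp: T1_def overlay_def below_def)
  define B where "B = {q \<in> Y. (fst q, snd q + 1) \<notin> Y \<and> T1 q \<noteq> Pos (k + 1)}"
  show ?case
  proof (cases "B = {}")
    case True
    have "T1 q = Pos (k + 1) \<longleftrightarrow> (fst q, snd q + 1) \<notin> Y" if q: "q \<in> Y" for q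
    proof
      assume "T1 q = Pos (k + 1)"
      then show "(fst q, snd q + 1) \<notin> Y"
        using bounded_tableaux_row_less_Pos[OF T1_mem, of "fst q" "snd q" "snd q + 1" "k + 1"] q
          bounded_tableaux_entry(2)[OF T1_mem, of "(fst q, snd q + 1)"] by auto
    next
      assume "(fst q, snd q + 1) \<notin> Y"
      moreover have "q \<notin> B" using True by simp
      ultimately show "T1 q = Pos (k + 1)" using q by (simp add: B_def)
    qed
    then show ?thesis using T1 by blast
  next
    case False
    have "finite B" using finite_young_diagram[OF Y] by (simp add: B_def)
    then obtain p where "p \<in> B" and max: "\<And>q. q \<in> B \<Longrightarrow> fst q \<le> fst p"
      using finite_arg_max[OF _ False, of fst] by blast
    then obtain i j where p: "(i, j) \<in> Y" "(i, j + 1) \<notin> Y" "T1 (i, j) \<noteq> Pos (k + 1)" and ij: "p = (i, j)"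
      by (cases p) (auto simp: B_def)
    have bottommost: "T1 (a, b) = Pos (k + 1)" if "(a, b) \<in> Y" "(a, b + 1) \<notin> Y" "i < a" for a b
      using max[of "(a, b)"] that by (force simp: B_def ij)
    define T2 where "T2 = T1((i, j) := Pos (k + 1))"
    have "T2 \<in> bounded_tableaux m n (Pos (k + 1)) Y" and "arrow_at Y T1 (i, j) (Pos (k + 1))"
      using raise_row_end[OF Y T1_mem k(1) letters(2) _ p] lowered bottommost unfolding Z1 T2_def by blast+
    then have T2: "linked m n (Pos (k + 1)) Y T1 T2"
      using linked.arrow[OF T1_mem _ p(1)] by (simp only: T2_def)
    have "below (Pos (k + 1)) Y T2 = ?Z - {(i, j)}"
      unfolding Z1[symmetric] by (auto simp: T2_def below_def)
    moreover have "(i, j) \<in> ?Z" using p unfolding Z1[symmetric] by (simp add: below_def)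
    ultimately have "card (below (Pos (k + 1)) Y T2) < card ?Z"
      using finite_young_diagram[OF Z] by (simp only: card_Diff1_less)
    from less.hyps[OF this linked_bounded_tableaux[OF T2, THEN conjunct2]]
    obtain T' where "linked m n (Pos (k + 1)) Y T2 T'" "\<forall>q \<in> Y. T' q = Pos (k + 1) \<longleftrightarrow> (fst q, snd q + 1) \<notin> Y" by blast
    then show ?thesis using linked.trans[OF linked.trans[OF T1 T2]] by blast
  qed
qed

section \<open>Removing the letter 1 from the first m rows\<close>

lemma Bar_entry_row_bound:
  assumes Y: "young_diagram Y" and T: "T \<in> bounded_tableaux m n (Bar c) Y"
    and "(i, j) \<in> Y" "T (i, j) = Bar l"
  shows "l + i \<le> m + 1"
  using assms(3,4)
proof (induction i arbitrary: l)
  case 0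
  then show ?case using young_diagram_memD(1)[OF Y] by fastforce
next
  case (Suc i)
  have l: "l \<le> m" using bounded_tableaux_entry(1)[OF T Suc.prems(1)] Suc.prems(2)
    by (auto simp: letters_def letters_plus_def letters_minus_def)
  show ?case
  proof (cases i)
    case 0
    then show ?thesis using l by simp
  next
    case (Suc i')
    then have mem: "(i, j) \<in> Y"
      using young_diagram_memD[OF Y Suc.prems(1)] by simp
    then have "T (i, j) < Bar l"
      using bounded_tableaux_column_less[OF T mem Suc.prems(1)] Suc.prems(2) by simp
    then obtain l' where l': "T (i, j) = Bar l'" "l < l'"
      by (cases "T (i, j)") (auto simp: less_le_not_le)
    show ?thesis using Suc.IH[OF mem l'(1)] l'(2) by simp
  qed
qed

lemma bounded_tableaux_Bar_row_le:
  assumes Y: "young_diagram Y" and T: "T \<in> bounded_tableaux m n (Bar c) Y" and "(i, j) \<in> Y"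
  shows "i \<le> m"
proof -
  obtain l where l: "T (i, j) = Bar l"
    using bounded_tableaux_entry(2)[OF T assms(3)] by (cases "T (i, j)") auto
  moreover have "1 \<le> l" using bounded_tableaux_entry(1)[OF T assms(3)] l
    by (auto simp: letters_def letters_plus_def letters_minus_def)
  ultimately show ?thesis using Bar_entry_row_bound[OF assms l] by simp
qed

text \<open>The highest weight tableau for the letters in $\mathbf B_+$.  Its role is that $\overline1$ occurs in
row \<open>m\<close> only, hence far to the left, where it is read late.\<close>

lemma highest_tableau:
  assumes Y: "young_diagram Y" and rows: "\<And>i j. (i, j) \<in> Y \<Longrightarrow> i \<le> m"
  shows "(\<lambda>(i, j). Bar (m + 1 - i)) \<in> bounded_tableaux m n (Bar 1) Y"
proof (rule bounded_tableauxI, goal_cases)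
  case (1 p)
  then show ?case
    using rows[of "fst p" "snd p"] young_diagram_memD(1)[OF Y, of "fst p" "snd p"]
    by (auto simp: letters_def letters_plus_def split: prod.splits intro!: imageI)
next
  case (2 i j j')
  then show ?case using rows[OF 2(1)] young_diagram_memD(1)[OF Y 2(1)] by (auto simp: letters_plus_def intro!: imageI)
next
  case (3 i i' j)
  then show ?case using rows[OF 3(2)] by auto
qed

lemma finite_first_read:
  assumes "finite B" "B \<noteq> {}"
  shows "\<exists>p \<in> B. \<forall>q \<in> B. \<not> read_before q p"
  using assms
proof (induction B rule: finite_ne_induct)
  case (singleton p)
  then show ?case by (simp add: read_before_def)
next
  case (insert q B)
  then obtain p where p: "p \<in> B" "\<forall>q \<in> B. \<not> read_before q p" by blast
  show ?case
  proof (cases "read_before q p")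
    case True
    then have "\<not> read_before q' q" if "q' \<in> insert q B" for q'
      using that p(2) by (auto simp: read_before_def)
    then show ?thesis by blast
  next
    case False
    then show ?thesis using p by blast
  qed
qed

text \<open>The odd operators see only the first of the letters $\overline1$ and $1$ in the reading word, and
$\tilde f_0$ cannot be repeated; so here the letter 1 is removed instead of created.  If some 1 lies in
the first \<open>m\<close> rows, then so does the first 1 in reading order, and every $\overline1$, being in row \<open>m\<close>
of the highest weight tableau, is read later than that 1.  Turning this 1 into $\overline1$ is
the inverse of an arrow.\<close>

lemma lower_first_Pos:
  assumes Y: "young_diagram Y" and T: "T \<in> bounded_tableaux m n (Pos 1) Y" and m: "1 \<le> m"
    and highest: "\<And>a b. (a, b) \<in> below (Pos 1) Y T \<Longrightarrow> T (a, b) = Bar (m + 1 - a) \<and> a \<le> m"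
    and p: "(i, j) \<in> Y" "T (i, j) = Pos 1"
    and first: "\<And>q. q \<in> Y \<Longrightarrow> T q = Pos 1 \<Longrightarrow> \<not> read_before q (i, j)"
    and top: "(i0, j0) \<in> Y" "T (i0, j0) = Pos 1" "i0 \<le> m"
  shows "T((i, j) := Bar 1) \<in> bounded_tableaux m n (Pos 1) Y"
    and "arrow_at Y (T((i, j) := Bar 1)) (i, j) (Pos 1)"
proof -
  have letter: "Bar 1 \<in> letters m n" "Bar 1 \<in> letters_plus m"
    using m by (auto simp: letters_def letters_plus_def)
  have ij: "1 \<le> i" "1 \<le> j" using young_diagram_memD[OF Y p(1)] by auto
  have less: "Bar 1 < Pos 1" by (simp add: less_le_not_le)
  have max: "T q \<le> Pos 1" if "q \<in> Y" for q by (rule bounded_tableaux_entry(2)[OF T that])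
  have "i \<le> m"
  proof (cases "j0 = j")
    case True
    then show ?thesis using first[OF top(1,2)] top(3) by (auto simp: read_before_def)
  next
    case False
    then have j0: "j0 < j" using first[OF top(1,2)] by (auto simp: read_before_def)
    show ?thesis
    proof (rule ccontr)
      assume "\<not> i \<le> m"
      then have mem: "(i0, j) \<in> Y" and "i0 < i"
        using young_diagram_memD(3)[OF Y p(1), of i0 j] young_diagram_memD(1)[OF Y top(1)] ij top(3) by auto
      \<comment> \<open>Otherwise column \<open>j\<close> would contain a 1 above row \<open>i\<close>, forced by the 1 in row \<open>i0\<close> to its left.\<close>
      have "T (i0, j) = Pos 1"
        using bounded_tableaux_row(1)[OF T top(1) mem j0] top(2) max[OF mem] by simp
      then show False using first[OF mem] \<open>i0 < i\<close> by (simp add: read_before_def)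
    qed
  qed
  show "T((i, j) := Bar 1) \<in> bounded_tableaux m n (Pos 1) Y"
  proof (rule bounded_tableaux_fun_upd[OF T letter(1)], goal_cases)
    case 1
    then show ?case by simp
  next
    case (2 j')
    have "T (i, j') < Pos 1"
      using bounded_tableaux_row_Pos_less[OF T 2(1) p(1) 2(2) p(2)] p(2) by simp
    then have "T (i, j') \<le> Bar 1"
      using covers_Zero[of m n] bounded_tableaux_entry(1)[OF T 2(1)] by (auto simp: covers_def)
    then show ?case using letter(2) by simp
  next
    case (3 j')
    then show ?case
      using bounded_tableaux_row_less_Pos[OF T p(1) 3(1) 3(2) p(2)] max[OF 3(1)] p(2) by simp
  next
    case (4 i')
    have "T (i', j) \<noteq> Pos 1" using first[OF 4(1)] 4(2) by (auto simp: read_before_def)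
    then have "T (i', j) = Bar (m + 1 - i')" using highest[of i' j] 4(1) by (simp add: below_def)
    then show ?case using 4(2) \<open>i \<le> m\<close> by auto
  next
    case (5 i')
    then have "T (i', j) = Pos 1"
      using bounded_tableaux_column(1)[OF T p(1) 5(1) 5(2)] p(2) max[OF 5(1)] by simp
    then show ?case by simp
  qed
  have "T q \<noteq> Bar 1" if q: "q \<in> Y" "read_before q (i, j)" for q
  proof
    assume Tq: "T q = Bar 1"
    obtain a b where ab: "q = (a, b)" by (cases q)
    have "a = m" using highest[of a b] q(1) Tq by (auto simp: ab below_def)
    then have "j < b" using q(2) \<open>i \<le> m\<close> by (auto simp: ab read_before_def)
    then have "T (i, j) \<le> T q"
      using bounded_tableaux_monotone[OF Y T, of a b i j] q(1) ij \<open>i \<le> m\<close> \<open>a = m\<close> by (simp add: ab)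
    then show False using Tq p(2) less by simp
  qed
  then show "arrow_at Y (T((i, j) := Bar 1)) (i, j) (Pos 1)"
    using first by (intro arrow_at.Zero) (auto simp: read_before_def)
qed

lemma linked_to_Bar_rows:
  assumes y: "all_linked m n (Bar 1)" and m: "1 \<le> m"
    and Y: "young_diagram Y" and "T \<in> bounded_tableaux m n (Pos 1) Y"
  shows "\<exists>T'. linked m n (Pos 1) Y T T' \<and> (\<forall>q \<in> Y. T' q = Pos 1 \<longleftrightarrow> m < fst q)"
  using assms(4)
proof (induction "card {q \<in> Y. T q = Pos 1}" arbitrary: T rule: less_induct)
  case less
  let ?Z = "below (Pos 1) Y T"
  have Z: "young_diagram ?Z" by (rule young_diagram_below[OF Y less.prems])
  have rows: "i \<le> m" if "(i, j) \<in> ?Z" for i j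
    by (rule bounded_tableaux_Bar_row_le[OF Z bounded_tableaux_below[OF covers_Zero less.prems] that])
  show ?case
  proof (cases "\<exists>q \<in> Y. T q = Pos 1 \<and> fst q \<le> m")
    case False
    then have "\<forall>q \<in> Y. T q = Pos 1 \<longleftrightarrow> m < fst q"
      using rows by (force simp: below_def)
    then show ?thesis using linked.agree[OF less.prems less.prems] by blast
  next
    case True
    then obtain i0 j0 where top: "(i0, j0) \<in> Y" "T (i0, j0) = Pos 1" "i0 \<le> m" by auto
    define T1 where "T1 = overlay (Pos 1) T (\<lambda>(i, j). Bar (m + 1 - i))"
    have T1: "linked m n (Pos 1) Y T T1"
      unfolding T1_def
      by (rule linked_to_overlay[OF y covers_Zero Y less.prems highest_tableau[OF Z rows]])
    note T1_mem = linked_bounded_tableaux[OF T1, THEN conjunct2]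
    have T1_Pos: "T1 q = Pos 1 \<longleftrightarrow> T q = Pos 1" for q
      by (auto simp: T1_def overlay_def split: prod.splits)
    have highest: "T1 (a, b) = Bar (m + 1 - a) \<and> a \<le> m" if "(a, b) \<in> below (Pos 1) Y T1" for a b
      using that rows[of a b] T1_Pos by (auto simp: T1_def overlay_def below_def)
    have "finite {q \<in> Y. T1 q = Pos 1}" "{q \<in> Y. T1 q = Pos 1} \<noteq> {}"
      using finite_young_diagram[OF Y] top T1_Pos by auto
    from finite_first_read[OF this] obtain i j where p: "(i, j) \<in> Y" "T1 (i, j) = Pos 1"
      and first: "\<And>q. q \<in> Y \<Longrightarrow> T1 q = Pos 1 \<Longrightarrow> \<not> read_before q (i, j)" by auto
    define T2 where "T2 = T1((i, j) := Bar 1)"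
    note lower = lower_first_Pos[OF Y T1_mem m highest p first top(1) _ top(3), folded T2_def]
    \<comment> \<open>The arrow leads from \<open>T2\<close> to \<open>T1\<close>: it is $\tilde f_0$ that puts the letter 1 back.\<close>
    have T1_eq: "T1 = T2((i, j) := Pos 1)" using p(2) by (auto simp: T2_def)
    have T2_mem: "T2 \<in> bounded_tableaux m n (Pos 1) Y" and arrow: "arrow_at Y T2 (i, j) (Pos 1)"
      using lower top(2) T1_Pos by blast+
    have "linked m n (Pos 1) Y T2 T1"
      using linked.arrow[OF T2_mem _ p(1) arrow] T1_mem by (simp only: T1_eq[symmetric])
    then have T2: "linked m n (Pos 1) Y T1 T2" by (rule linked.sym)
    have "{q \<in> Y. T2 q = Pos 1} = {q \<in> Y. T q = Pos 1} - {(i, j)}"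
      using T1_Pos by (auto simp: T2_def)
    moreover have "(i, j) \<in> {q \<in> Y. T q = Pos 1}" using p T1_Pos by simp
    moreover have "finite {q \<in> Y. T q = Pos 1}" using finite_young_diagram[OF Y] by simp
    ultimately have "card {q \<in> Y. T2 q = Pos 1} < card {q \<in> Y. T q = Pos 1}"
      by (simp only: card_Diff1_less)
    from less.hyps[OF this T2_mem]
    obtain T' where "linked m n (Pos 1) Y T2 T'" "\<forall>q \<in> Y. T' q = Pos 1 \<longleftrightarrow> m < fst q" by blast
    then show ?thesis using linked.trans[OF linked.trans[OF T1 T2]] by blast
  qed
qed

section \<open>Connectedness\<close>

lemma all_linked_first: "all_linked m n (Bar m)"
  unfolding all_linked_def
proof (intro allI impI ballI)
  fix Y T T' assume T: "T \<in> bounded_tableaux m n (Bar m) Y" and T': "T' \<in> bounded_tableaux m n (Bar m) Y"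
  have "l = Bar m" if "l \<in> letters m n" "l \<le> Bar m" for l
    using that by (cases l) (auto simp: letters_def letters_plus_def letters_minus_def)
  then have "T p = T' p" if "p \<in> Y" for p
    using bounded_tableaux_entry[OF T that] bounded_tableaux_entry[OF T' that] by metis
  then show "linked m n (Bar m) Y T T'" by (rule linked.agree[OF T T'])
qed

lemma all_linked_Bar:
  assumes "1 \<le> k" "k \<le> m"
  shows "all_linked m n (Bar k)"
  using assms(2,1)
proof (induction rule: inc_induct)
  case base
  show ?case by (rule all_linked_first)
next
  case (step k)
  then have y: "all_linked m n (Bar (k + 1))" and k: "1 \<le> k" "k < m" by simp_all
  show ?case
    by (rule all_linked_step[OF y covers_Bar, where P = "\<lambda>Y q. (fst q + 1, snd q) \<notin> Y"])
      (rule linked_to_full_columns[OF y k])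
qed

lemma all_linked_Pos:
  assumes "1 \<le> m" "1 \<le> k" "k \<le> n"
  shows "all_linked m n (Pos k)"
  using assms(2,3)
proof (induction rule: dec_induct)
  case base
  have y: "all_linked m n (Bar 1)" using assms(1) by (intro all_linked_Bar) auto
  show ?case
    by (rule all_linked_step[OF y covers_Zero, where P = "\<lambda>Y q. m < fst q"])
      (rule linked_to_Bar_rows[OF y assms(1)])
next
  case (step k)
  then have y: "all_linked m n (Pos k)" and k: "1 \<le> k" "k < n" by simp_all
  have "all_linked m n (Pos (k + 1))"
    by (rule all_linked_step[OF y covers_Pos, where P = "\<lambda>Y q. (fst q, snd q + 1) \<notin> Y"])
      (rule linked_to_full_rows[OF y k])
  then show ?case by simp
qed

text \<open>The genuine highest weight tableau; the hook condition enters because the rows below row \<open>m\<close> are filled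
with $1,2,3,\dots$, which must not exceed \<open>n\<close>.\<close>

lemma semistandard_exists:
  assumes "hook_young_diagram m n Y"
  shows "semistandard m n Y (\<lambda>(i, j). if i \<le> m then Bar (m + 1 - i) else Pos j)"
proof -
  have Y: "young_diagram Y" and "row_length Y (m + 1) \<le> n"
    using assms by (auto simp: hook_young_diagram_def)
  have "j \<le> n" if "(i, j) \<in> Y" "m < i" for i j
  proof -
    have "(m + 1, j) \<in> Y" using young_diagram_memD[OF Y that(1)] that(2) by simp
    then have "j \<in> {1..row_length Y (m + 1)}" using young_diagram_row[OF Y, of "m + 1"] by blast
    then show ?thesis using \<open>row_length Y (m + 1) \<le> n\<close> by simp
  qed
  moreover have "1 \<le> i \<and> 1 \<le> j" if "(i, j) \<in> Y" for i j
    using young_diagram_memD[OF Y that] by simp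
  ultimately have entry: "(i, j) \<in> Y \<Longrightarrow> 1 \<le> i \<and> 1 \<le> j \<and> (m < i \<longrightarrow> j \<le> n)" for i j
    by blast
  let ?T = "\<lambda>(i, j). if i \<le> m then Bar (m + 1 - i) else Pos j"
  have "?T \<in> bounded_tableaux m n (Pos n) Y"
  proof (rule bounded_tableauxI, goal_cases)
    case (1 p)
    then show ?case
      using entry[of "fst p" "snd p"]
      by (auto simp: letters_def letters_plus_def letters_minus_def split: prod.splits intro!: imageI)
  next
    case (2 i j j')
    then show ?case using entry[OF 2(1)] by (auto simp: letters_plus_def intro!: imageI)
  next
    case (3 i i' j)
    then show ?case using entry[OF 3(1)] entry[OF 3(2)] by (auto simp: letters_minus_def intro!: imageI)
  qed
  then show ?thesis by (simp add: bounded_tableaux_def)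
qed

theorem theorem4p8:
  fixes m n :: nat and Y :: "(nat \<times> nat) set"
  assumes "m \<ge> 1" and "n \<ge> 1"
    and "hook_young_diagram m n Y"
  shows "crystal_connected (indices m n) (tableau_crystal m n Y)"
proof -
  have Y: "young_diagram Y" using assms(3) by (simp add: hook_young_diagram_def)
  have mem: "T \<in> bounded_tableaux m n (Pos n) Y" if "semistandard m n Y T" for T
    using that by (auto simp: bounded_tableaux_def semistandard_def letters_def letters_plus_def letters_minus_def)
  have "linked m n (Pos n) Y T T'" if "semistandard m n Y T" "semistandard m n Y T'" for T T'
    using all_linked_Pos[OF assms(1,2)] Y mem[OF that(1)] mem[OF that(2)]
    unfolding all_linked_def by blast
  note reachable = linked_imp_reachable[OF Y this]
  have verts: "verts (crystal_graph (indices m n) (tableau_crystal m n Y)) =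
      {reading_word Y T | T. semistandard m n Y T}"
    by (simp add: crystal_graph_def tableau_crystal_def)
  show ?thesis
    unfolding crystal_connected_def connected_def
    by (rule strongly_connectedI)
      (use semistandard_exists[OF assms(3)] reachable in \<open>auto simp: verts\<close>)
qed

end
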